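(* A flat totally geodesic almost complex surface $M$ of the nearly Kähler manifold $(SL(2,\mathbb{R})\times SL(2,\mathbb{R}),g,J)$ with positive definite induced metric is isometric (i.e. congruent by an isometry of the ambient space) to the immersion $(s,t)\mapsto (A(s,t),B(s,t))$, where $$A(s,t)=\begin{pmatrix} e^{\frac{1}{\sqrt2}(\sqrt3 s-t)}&0\\0&e^{-\frac{1}{\sqrt2}(\sqrt3 s-t)}\end{pmatrix}\quad\text{and}\quad B(s,t)=\begin{pmatrix} e^{\frac{1}{\sqrt2}(\sqrt3 s+t)}&0\\0&e^{-\frac{1}{\sqrt2}(\sqrt3 s+t)}\end{pmatrix},\qquad (s,t)\in\mathbb{R}^2.$$
   Context: For trace-zero real $2\times2$ matrices put $\langle\alpha,\beta\rangle=\tfrac12\operatorname{Trace}(\alpha\beta)$. One has $T_ASL(2,\mathbb{R})=\{A\alpha:\operatorname{Trace}\alpha=0\}$, so tangent vectors of $SL(2,\mathbb{R})\times SL(2,\mathbb{R})$ at $(A,B)$ are the pairs $(A\alpha,B\beta)$ with $\alpha,\beta$ real $2\times 2$ matrices of trace $0$. The pseudo-Riemannian metric $g$ and the almost complex structure $J$ are $$g((A\alpha,B\beta),(A\gamma,B\delta))=\tfrac23\big(\langle\alpha,\gamma\rangle+\langle\beta,\delta\rangle\big)-\tfrac13\big(\langle\beta,\gamma\rangle+\langle\alpha,\delta\rangle\big),$$ $$J(A\alpha,B\beta)=\tfrac{1}{\sqrt3}\big(A(\alpha-2\beta),B(2\alpha-\beta)\big).$$ With these, $(SL(2,\mathbb{R})\times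 SL(2,\mathbb{R}),g,J)$ is a nearly Kähler manifold. An almost complex surface is an immersed 2-dimensional connected submanifold $M$ (with immersion $F$) whose tangent spaces are $J$-invariant. The second fundamental form $h$ and the Gaussian curvature (of the induced metric) are taken with respect to $g$. Totally geodesic means $h=0$; flat means Gaussian curvature $0$. $M$ is congruent to a surface with image $\Sigma\subset SL(2,\mathbb{R})\times SL(2,\mathbb{R})$ if there is an isometry $\Phi$ of $(SL(2,\mathbb{R})\times SL(2,\mathbb{R}),g)$ such that $\Phi(F(M))$ is an open part of $\Sigma$. *)

theory Defs
  imports "HOL-Analysis.Analysis"
begin

section \<open>Smooth maps and abstract smooth manifolds\<close>

text \<open>\<open>Ck_on k S f\<close> is meant for open \<open>S\<close>. On finite-dimensional domains the recursion over
  directional derivatives gives the usual class \<open>C^k\<close>: differentiability of all derivatives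
  of order below \<open>k\<close> and continuity of those of order \<open>k\<close>.\<close>

primrec Ck_on :: "nat \<Rightarrow> 'a::real_normed_vector set \<Rightarrow> ('a \<Rightarrow> 'b::real_normed_vector) \<Rightarrow> bool" where
  "Ck_on 0 S f \<longleftrightarrow> continuous_on S f"
| "Ck_on (Suc k) S f \<longleftrightarrow>
     (\<forall>x\<in>S. f differentiable (at x)) \<and> (\<forall>v. Ck_on k S (\<lambda>x. frechet_derivative f (at x) v))"

definition smooth_on :: "'a::real_normed_vector set \<Rightarrow> ('a \<Rightarrow> 'b::real_normed_vector) \<Rightarrow> bool" where
  "smooth_on S f \<longleftrightarrow> (\<forall>k. Ck_on k S f)"

abbreviation deriv_at :: "('a::real_normed_vector \<Rightarrow> 'b::real_normed_vector) \<Rightarrow> 'a \<Rightarrow> 'a \<Rightarrow> 'b" where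
  "deriv_at f p \<equiv> frechet_derivative f (at p)"

text \<open>A chart is a pair of its domain and its coordinate map.\<close>

type_synonym ('m, 'n) chart = "'m set \<times> ('m \<Rightarrow> real ^ 'n)"

definition is_chart :: "'m topology \<Rightarrow> ('m, 'n::finite) chart \<Rightarrow> bool" where
  "is_chart M c \<longleftrightarrow> (case c of (U, \<phi>) \<Rightarrow>
     openin M U \<and> open (\<phi> ` U) \<and>
     homeomorphic_map (subtopology M U) (top_of_set (\<phi> ` U)) \<phi>)"

definition smooth_manifold :: "'m topology \<Rightarrow> ('m, 'n::finite) chart set \<Rightarrow> bool" where
  "smooth_manifold M \<A> \<longleftrightarrow>
     Hausdorff_space M \<and> second_countable M \<and>
     (\<forall>c\<in>\<A>. is_chart M c) \<and>
     (\<Union>c\<in>\<A>. fst c) = topspace M \<and>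
     (\<forall>(U, \<phi>)\<in>\<A>. \<forall>(U', \<phi>')\<in>\<A>. smooth_on (\<phi> ` (U \<inter> U')) (\<phi>' \<circ> inv_into U \<phi>))"

text \<open>\<open>local_expr F (U, \<phi>)\<close> is the map \<open>F\<close> read in the chart \<open>(U, \<phi>)\<close>; it is
  meaningful on the open set \<open>\<phi> ` U\<close>.\<close>

definition local_expr :: "('m \<Rightarrow> 'b) \<Rightarrow> ('m, 'n::finite) chart \<Rightarrow> real ^ 'n \<Rightarrow> 'b" where
  "local_expr F c = F \<circ> inv_into (fst c) (snd c)"

abbreviation chart_image :: "('m, 'n::finite) chart \<Rightarrow> (real ^ 'n) set" where
  "chart_image c \<equiv> snd c ` fst c"


section \<open>The ambient manifold \<open>SL(2,\<real>) \<times> SL(2,\<real>)\<close>\<close>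

type_synonym mat2 = "real ^ 2 ^ 2"

definition SL2 :: "mat2 set" where
  "SL2 = {A. det A = 1}"

definition SLSL :: "(mat2 \<times> mat2) set" where
  "SLSL = SL2 \<times> SL2"

definition sl2 :: "mat2 set" where
  "sl2 = {\<alpha>. trace \<alpha> = 0}"

definition tangent_space :: "mat2 \<times> mat2 \<Rightarrow> (mat2 \<times> mat2) set" where
  "tangent_space p = {(fst p ** \<alpha>, snd p ** \<beta>) | \<alpha> \<beta>. \<alpha> \<in> sl2 \<and> \<beta> \<in> sl2}"

definition sl2_form :: "mat2 \<Rightarrow> mat2 \<Rightarrow> real" where
  "sl2_form \<alpha> \<beta> = 1 / 2 * trace (\<alpha> ** \<beta>)"

text \<open>The matrices \<open>\<alpha>, \<beta>\<close> of a tangent vector \<open>(A\<alpha>, B\<beta>)\<close> are recovered by multiplying with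
  \<open>A\<^sup>-\<^sup>1\<close> and \<open>B\<^sup>-\<^sup>1\<close>.\<close>

definition metric_g :: "mat2 \<times> mat2 \<Rightarrow> mat2 \<times> mat2 \<Rightarrow> mat2 \<times> mat2 \<Rightarrow> real" where
  "metric_g p v w =
     (let \<alpha> = matrix_inv (fst p) ** fst v; \<beta> = matrix_inv (snd p) ** snd v;
          \<gamma> = matrix_inv (fst p) ** fst w; \<delta> = matrix_inv (snd p) ** snd w
      in 2 / 3 * (sl2_form \<alpha> \<gamma> + sl2_form \<beta> \<delta>) - 1 / 3 * (sl2_form \<beta> \<gamma> + sl2_form \<alpha> \<delta>))"

definition complex_J :: "mat2 \<times> mat2 \<Rightarrow> mat2 \<times> mat2 \<Rightarrow> mat2 \<times> mat2" where
  "complex_J p v =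
     (let \<alpha> = matrix_inv (fst p) ** fst v; \<beta> = matrix_inv (snd p) ** snd v
      in (1 / sqrt 3) *\<^sub>R (fst p ** (\<alpha> - 2 *\<^sub>R \<beta>), snd p ** (2 *\<^sub>R \<alpha> - \<beta>)))"


section \<open>Levi-Civita connection of \<open>g\<close>\<close>

text \<open>As \<open>SLSL\<close> is a closed submanifold of the vector space of pairs of matrices, its smooth
  vector fields are exactly the restrictions of smooth vector-valued maps on the whole space
  that are tangent at the points of \<open>SLSL\<close>.\<close>

definition vector_field :: "(mat2 \<times> mat2 \<Rightarrow> mat2 \<times> mat2) \<Rightarrow> bool" where
  "vector_field X \<longleftrightarrow> smooth_on UNIV X \<and> (\<forall>p\<in>SLSL. X p \<in> tangent_space p)"

definition lie_bracket ::
  "(mat2 \<times> mat2 \<Rightarrow> mat2 \<times> mat2) \<Rightarrow> (mat2 \<times> mat2 \<Rightarrow> mat2 \<times> mat2) \<Rightarrow> mat2 \<times> mat2 \<Rightarrow> mat2 \<times> mat2" where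
  "lie_bracket X Y p = deriv_at Y p (X p) - deriv_at X p (Y p)"

text \<open>Every affine connection on \<open>SLSL\<close> differs from the flat derivative \<open>D\<close> of the surrounding
  vector space by a tensor \<open>\<Gamma>\<close> with values in that vector space,
  i.e. \<open>\<nabla>\<^sub>X Y = D\<^sub>X Y + \<Gamma>(X, Y)\<close>.  The additivity and Leibniz rules then hold automatically;
  tangency of \<open>\<nabla>\<^sub>X Y\<close> is a condition on \<open>\<Gamma>\<close>.  Recording \<open>\<Gamma>\<close> makes the connection
  directly applicable to fields along a map.\<close>

type_synonym connection_form = "mat2 \<times> mat2 \<Rightarrow> mat2 \<times> mat2 \<Rightarrow> mat2 \<times> mat2 \<Rightarrow> mat2 \<times> mat2"

definition covariant_derivative ::
  "connection_form \<Rightarrow> (mat2 \<times> mat2 \<Rightarrow> mat2 \<times> mat2) \<Rightarrow> (mat2 \<times> mat2 \<Rightarrow> mat2 \<times> mat2)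
     \<Rightarrow> mat2 \<times> mat2 \<Rightarrow> mat2 \<times> mat2" where
  "covariant_derivative \<Gamma> X Y p = deriv_at Y p (X p) + \<Gamma> p (X p) (Y p)"

text \<open>The conditions below determine \<open>\<Gamma> p\<close> uniquely on pairs of tangent vectors.
  In the metric condition \<open>\<lambda>q. metric_g q (Y q) (Z q)\<close> is smooth on a neighbourhood of \<open>SLSL\<close>,
  and it is differentiated in a tangential direction, so that only its restriction to \<open>SLSL\<close>
  matters.\<close>

definition is_levi_civita :: "connection_form \<Rightarrow> bool" where
  "is_levi_civita \<Gamma> \<longleftrightarrow>
     (\<forall>p\<in>SLSL. bilinear (\<Gamma> p)) \<and>
     (\<forall>X Y. vector_field X \<and> vector_field Y \<longrightarrow> (\<forall>p\<in>SLSL.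
        covariant_derivative \<Gamma> X Y p \<in> tangent_space p \<and>
        covariant_derivative \<Gamma> X Y p - covariant_derivative \<Gamma> Y X p = lie_bracket X Y p)) \<and>
     (\<forall>X Y Z. vector_field X \<and> vector_field Y \<and> vector_field Z \<longrightarrow> (\<forall>p\<in>SLSL.
        deriv_at (\<lambda>q. metric_g q (Y q) (Z q)) p (X p) =
          metric_g p (covariant_derivative \<Gamma> X Y p) (Z p) +
          metric_g p (Y p) (covariant_derivative \<Gamma> X Z p)))"

definition levi_civita :: connection_form where
  "levi_civita = (SOME \<Gamma>. is_levi_civita \<Gamma>)"

definition cov_deriv_along ::
  "(real ^ 'n::finite \<Rightarrow> mat2 \<times> mat2) \<Rightarrow> real ^ 'n \<Rightarrow> (real ^ 'n \<Rightarrow> mat2 \<times> mat2)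
     \<Rightarrow> real ^ 'n \<Rightarrow> mat2 \<times> mat2" where
  "cov_deriv_along f x Y u = deriv_at Y u x + levi_civita (f u) (deriv_at f u x) (Y u)"


section \<open>Geometry of an immersion in local coordinates\<close>

text \<open>Here \<open>f\<close> is the immersion in a chart, and a coordinate vector \<open>x\<close> also stands for the
  constant vector field \<open>x\<close> on the chart domain.\<close>

definition normal_component :: "mat2 \<times> mat2 \<Rightarrow> (mat2 \<times> mat2) set \<Rightarrow> mat2 \<times> mat2 \<Rightarrow> mat2 \<times> mat2" where
  "normal_component p W v =
     (THE n. n \<in> tangent_space p \<and> (\<forall>w\<in>W. metric_g p n w = 0) \<and> v - n \<in> W)"

definition second_fundamental_form ::
  "(real ^ 'n::finite \<Rightarrow> mat2 \<times> mat2) \<Rightarrow> real ^ 'n \<Rightarrow> real ^ 'n \<Rightarrow> real ^ 'n \<Rightarrow> mat2 \<times> mat2" where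
  "second_fundamental_form f u x y =
     normal_component (f u) (range (deriv_at f u)) (cov_deriv_along f x (\<lambda>w. deriv_at f w y) u)"

definition induced_metric ::
  "(real ^ 'n::finite \<Rightarrow> mat2 \<times> mat2) \<Rightarrow> real ^ 'n \<Rightarrow> real ^ 'n ^ 'n" where
  "induced_metric f u =
     (\<chi> i j. metric_g (f u) (deriv_at f u (axis i 1)) (deriv_at f u (axis j 1)))"

definition partial :: "'n \<Rightarrow> (real ^ 'n::finite \<Rightarrow> real) \<Rightarrow> real ^ 'n \<Rightarrow> real" where
  "partial i \<phi> u = deriv_at \<phi> u (axis i 1)"

text \<open>\<open>christoffel G k i j\<close> is the symbol with upper index \<open>k\<close> and lower indices \<open>i, j\<close>.\<close>

definition christoffel :: "(real ^ 'n::finite \<Rightarrow> real ^ 'n ^ 'n) \<Rightarrow> 'n \<Rightarrow> 'n \<Rightarrow> 'n \<Rightarrow> real ^ 'n \<Rightarrow> real" where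
  "christoffel G k i j u = 1 / 2 * (\<Sum>l\<in>UNIV. matrix_inv (G u) $ k $ l *
     (partial i (\<lambda>w. G w $ j $ l) u + partial j (\<lambda>w. G w $ i $ l) u - partial l (\<lambda>w. G w $ i $ j) u))"

text \<open>\<open>riemann G l i j k\<close> is the coefficient of \<open>\<partial>\<^sub>l\<close> in \<open>R(\<partial>\<^sub>i, \<partial>\<^sub>j)\<partial>\<^sub>k\<close>, where
  \<open>R(X, Y) = [\<nabla>\<^sub>X, \<nabla>\<^sub>Y] - \<nabla>\<^bsub>[X,Y]\<^esub>\<close>.\<close>

definition riemann ::
  "(real ^ 'n::finite \<Rightarrow> real ^ 'n ^ 'n) \<Rightarrow> 'n \<Rightarrow> 'n \<Rightarrow> 'n \<Rightarrow> 'n \<Rightarrow> real ^ 'n \<Rightarrow> real" where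
  "riemann G l i j k u =
     partial i (christoffel G l j k) u - partial j (christoffel G l i k) u +
     (\<Sum>m\<in>UNIV. christoffel G m j k u * christoffel G l i m u
               - christoffel G m i k u * christoffel G l j m u)"

definition gauss_curvature :: "(real ^ 2 \<Rightarrow> real ^ 2 ^ 2) \<Rightarrow> real ^ 2 \<Rightarrow> real" where
  "gauss_curvature G u = (\<Sum>l\<in>UNIV. riemann G l 1 2 2 u * G u $ l $ 1) / det (G u)"


section \<open>Surfaces in \<open>SL(2,\<real>) \<times> SL(2,\<real>)\<close>\<close>

definition immersion ::
  "'m topology \<Rightarrow> ('m, 'n::finite) chart set \<Rightarrow> ('m \<Rightarrow> mat2 \<times> mat2) \<Rightarrow> bool" where
  "immersion M \<A> F \<longleftrightarrow> F ` topspace M \<subseteq> SLSL \<and>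
     (\<forall>c\<in>\<A>. smooth_on (chart_image c) (local_expr F c) \<and>
            (\<forall>u\<in>chart_image c. inj (deriv_at (local_expr F c) u)))"

definition almost_complex_surface ::
  "'m topology \<Rightarrow> ('m, 2) chart set \<Rightarrow> ('m \<Rightarrow> mat2 \<times> mat2) \<Rightarrow> bool" where
  "almost_complex_surface M \<A> F \<longleftrightarrow>
     smooth_manifold M \<A> \<and> connected_space M \<and> immersion M \<A> F \<and>
     (\<forall>c\<in>\<A>. \<forall>u\<in>chart_image c.
        complex_J (local_expr F c u) ` range (deriv_at (local_expr F c) u)
          \<subseteq> range (deriv_at (local_expr F c) u))"

definition positive_definite_induced_metric ::
  "('m, 2) chart set \<Rightarrow> ('m \<Rightarrow> mat2 \<times> mat2) \<Rightarrow> bool" where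
  "positive_definite_induced_metric \<A> F \<longleftrightarrow>
     (\<forall>c\<in>\<A>. \<forall>u\<in>chart_image c. \<forall>x. x \<noteq> 0 \<longrightarrow>
        metric_g (local_expr F c u) (deriv_at (local_expr F c) u x) (deriv_at (local_expr F c) u x) > 0)"

definition totally_geodesic :: "('m, 2) chart set \<Rightarrow> ('m \<Rightarrow> mat2 \<times> mat2) \<Rightarrow> bool" where
  "totally_geodesic \<A> F \<longleftrightarrow>
     (\<forall>c\<in>\<A>. \<forall>u\<in>chart_image c. \<forall>x y. second_fundamental_form (local_expr F c) u x y = 0)"

definition flat_surface :: "('m, 2) chart set \<Rightarrow> ('m \<Rightarrow> mat2 \<times> mat2) \<Rightarrow> bool" where
  "flat_surface \<A> F \<longleftrightarrow>
     (\<forall>c\<in>\<A>. \<forall>u\<in>chart_image c. gauss_curvature (induced_metric (local_expr F c)) u = 0)"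


section \<open>Congruence\<close>

text \<open>A diffeomorphism of the closed submanifold \<open>SLSL\<close> and its inverse extend smoothly to open
  neighbourhoods; on tangent vectors the derivative does not depend on the extension.\<close>

definition ambient_isometry :: "(mat2 \<times> mat2 \<Rightarrow> mat2 \<times> mat2) \<Rightarrow> bool" where
  "ambient_isometry \<Phi> \<longleftrightarrow>
     bij_betw \<Phi> SLSL SLSL \<and>
     (\<exists>W. open W \<and> SLSL \<subseteq> W \<and> smooth_on W \<Phi>) \<and>
     (\<exists>W \<Psi>. open W \<and> SLSL \<subseteq> W \<and> smooth_on W \<Psi> \<and> (\<forall>p\<in>SLSL. \<Psi> (\<Phi> p) = p)) \<and>
     (\<forall>p\<in>SLSL. \<forall>v\<in>tangent_space p. \<forall>w\<in>tangent_space p.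
        metric_g (\<Phi> p) (deriv_at \<Phi> p v) (deriv_at \<Phi> p w) = metric_g p v w)"

definition congruent_to ::
  "'m topology \<Rightarrow> ('m \<Rightarrow> mat2 \<times> mat2) \<Rightarrow> (mat2 \<times> mat2) set \<Rightarrow> bool" where
  "congruent_to M F \<Sigma> \<longleftrightarrow>
     (\<exists>\<Phi>. ambient_isometry \<Phi> \<and> openin (top_of_set \<Sigma>) (\<Phi> ` F ` topspace M))"

definition diag2 :: "real \<Rightarrow> real \<Rightarrow> mat2" where
  "diag2 a b = vector [vector [a, 0], vector [0, b]]"

definition flat_A :: "real \<Rightarrow> real \<Rightarrow> mat2" where
  "flat_A s t = diag2 (exp (1 / sqrt 2 * (sqrt 3 * s - t))) (exp (- (1 / sqrt 2) * (sqrt 3 * s - t)))"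

definition flat_B :: "real \<Rightarrow> real \<Rightarrow> mat2" where
  "flat_B s t = diag2 (exp (1 / sqrt 2 * (sqrt 3 * s + t))) (exp (- (1 / sqrt 2) * (sqrt 3 * s + t)))"

end

theory Submission
  imports Defs
begin

text \<open>
  Left translation trivialises the tangent bundle: the tangent vector \<open>(A\<alpha>, B\<beta>)\<close> becomes the pair
  \<open>(\<alpha>, \<beta>)\<close> of trace-free matrices, and \<open>g\<close>, \<open>J\<close> and the Levi-Civita connection become constant
  multilinear maps \<open>gform\<close>, \<open>Jform\<close> and \<open>conn\<close> of such pairs; the covariant
  derivative of a trivialised field \<open>Y\<close> along \<open>X\<close> is its ordinary derivative plus \<open>conn X Y\<close>.
  In a chart let \<open>X\<^sub>1, X\<^sub>2\<close> be the trivialised partial derivatives of the immersion.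

  As the surface is totally geodesic, the ambient connection restricts to the Levi-Civita connection
  of the induced metric, so that the Riemann tensor of the induced metric is the ambient
  curvature tensor \<open>R\<close> (\<open>riemann_curv\<close>).  Hence \<open>R(X\<^sub>1, X\<^sub>2)X\<^sub>2\<close> is tangent to the surface; it is orthogonal
  to \<open>X\<^sub>1\<close> by flatness and to \<open>X\<^sub>2\<close> by skew-symmetry, and so it vanishes because the induced metric is
  definite (\<open>curv_zero\<close>).  The tangent plane is \<open>J\<close>-invariant, hence spanned by \<open>X\<^sub>2 = (\<alpha>, \<beta>)\<close> and \<open>J X\<^sub>2\<close>,
  and \<open>R(J X\<^sub>2, X\<^sub>2)X\<^sub>2\<close> is a multiple of \<open>([[\<alpha>,\<beta>],\<alpha>], [[\<alpha>,\<beta>],\<beta>])\<close> (\<open>curv_J\<close>).  If both double commutators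
  vanish while \<open>[\<alpha>,\<beta>]\<close> does not, the trace form is zero on the span of \<open>\<alpha>\<close> and \<open>\<beta>\<close>, which
  positivity excludes.  So \<open>\<alpha>\<close> and \<open>\<beta>\<close> commute.

  In \<open>sl(2,\<real>)\<close> commuting elements are proportional, so the tangent plane is
  \<open>{(a\<xi>, b\<xi>) | a b}\<close> for a single \<open>\<xi>\<close> with \<open>\<langle>\<xi>,\<xi>\<rangle> > 0\<close>.  On such a plane \<open>conn\<close> vanishes, and total geodesy
  says that all derivatives of \<open>\<xi>\<close> are multiples of \<open>\<xi>\<close>; the normalised \<open>\<xi>\<close> is locally constant
  (\<open>constant_direction\<close>).  It is conjugate to \<open>diag(1,-1)\<close>, say \<open>\<xi> = c diag(1,-1) c\<^sup>-\<^sup>1\<close>, and integration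
  gives \<open>A = A\<^sub>0 c diag(e\<^sup>x, e\<^sup>-\<^sup>x) c\<^sup>-\<^sup>1\<close> and \<open>B = B\<^sub>0 c diag(e\<^sup>y, e\<^sup>-\<^sup>y) c\<^sup>-\<^sup>1\<close>, where \<open>(x, y)\<close> are
  local coordinates on the surface.  Thus an isometry \<open>(A, B) \<mapsto> (aAc, bBc)\<close> carries a neighbourhood of each point
  to an open subset of the split torus, the group of pairs of positive diagonal matrices of determinant \<open>1\<close>, which is
  the image of the given immersion (\<open>local_torus\<close>, \<open>flat_torus\<close>).

  A priori the isometry depends on the point.  But an isometry of this form that maps one nonempty open piece of the
  split torus into the split torus maps all of it there (\<open>torus_rigid\<close>), so the coset that contains a neighbourhood
  of a point is a locally constant function of the point, and constant because the surface is connected.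
\<close>

section \<open>Smooth maps\<close>

lemma has_derivative_deriv_at: "f differentiable (at x) \<Longrightarrow> (f has_derivative deriv_at f x) (at x)"
  by (simp add: frechet_derivative_works)

lemma deriv_at_eq: "(f has_derivative f') (at x) \<Longrightarrow> deriv_at f x v = f' v"
  using frechet_derivative_at by metis

text \<open>\<open>Ck_on\<close> refers to derivatives at points and hence to values near \<open>S\<close>; for open \<open>S\<close> the values on
  \<open>S\<close> are enough.\<close>

lemma Ck_on_cong:
  assumes "open S" "\<And>x. x \<in> S \<Longrightarrow> f x = g x" "Ck_on k S f"
  shows "Ck_on k S g"
  using assms
proof (induction k arbitrary: f g)
  case 0
  then show ?case by (simp cong: continuous_on_cong)
next
  case (Suc k)
  have d: "f differentiable (at x)" if "x \<in> S" for x
    using Suc.prems that by simp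
  have eq: "frechet_derivative f (at x) = frechet_derivative g (at x)" if "x \<in> S" for x
    by (rule frechet_derivative_transform_within_open[OF d[OF that] \<open>open S\<close> that]) (use Suc.prems in auto)
  have "g differentiable (at x)" if x: "x \<in> S" for x
    using d[OF x] Suc.prems(1,2) x unfolding differentiable_def
    by (metis has_derivative_transform_within_open)
  moreover have "Ck_on k S (\<lambda>x. frechet_derivative g (at x) v)" for v
  proof (rule Suc.IH)
    show "Ck_on k S (\<lambda>x. frechet_derivative f (at x) v)"
      using Suc.prems(3) unfolding Ck_on.simps by (elim conjE allE)
  qed (simp_all add: eq \<open>open S\<close>)
  ultimately show ?case unfolding Ck_on.simps by blast
qed

lemma Ck_on_SucD: "Ck_on (Suc k) S f \<Longrightarrow> Ck_on k S f"
proof (induction k arbitrary: f)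
  case 0
  then show ?case
    by (simp add: continuous_at_imp_continuous_on differentiable_imp_continuous_within)
qed auto

lemma Ck_on_add:
  assumes "open S" "Ck_on k S f" "Ck_on k S g"
  shows "Ck_on k S (\<lambda>x. f x + g x)"
  using assms
proof (induction k arbitrary: f g)
  case (Suc k)
  have d: "f differentiable (at x)" "g differentiable (at x)" if "x \<in> S" for x
    using Suc.prems(2,3) that unfolding Ck_on.simps by blast+
  have eq: "deriv_at (\<lambda>x. f x + g x) x v
      = frechet_derivative f (at x) v + frechet_derivative g (at x) v" if "x \<in> S" for x v
    by (rule deriv_at_eq[OF has_derivative_add[OF d[THEN has_derivative_deriv_at]]]) (rule that)+
  have "Ck_on k S (\<lambda>x. deriv_at (\<lambda>x. f x + g x) x v)" for v
  proof (rule Ck_on_cong[OF \<open>open S\<close>])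
    show "Ck_on k S (\<lambda>x. deriv_at f x v + deriv_at g x v)"
      by (rule Suc.IH[OF \<open>open S\<close>]) (use Suc.prems(2,3) in \<open>(unfold Ck_on.simps, blast)+\<close>)
  qed (rule eq[symmetric])
  then show ?case
    unfolding Ck_on.simps using d by (intro conjI ballI allI differentiable_add) blast+
qed (simp add: continuous_on_add)

lemma deriv_at_linear:
  assumes "bounded_linear L" "f differentiable (at x)"
  shows "deriv_at (\<lambda>x. L (f x)) x v = L (deriv_at f x v)"
  by (rule deriv_at_eq[OF bounded_linear.has_derivative[OF assms(1) has_derivative_deriv_at[OF assms(2)]]])

lemma differentiable_linear:
  assumes "bounded_linear L" "f differentiable (at x)"
  shows "(\<lambda>x. L (f x)) differentiable (at x)"
  using bounded_linear.has_derivative[OF assms(1) has_derivative_deriv_at[OF assms(2)]]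
  by (rule differentiableI)

lemma deriv_at_bilinear:
  assumes "bounded_bilinear B" "f differentiable (at x)" "g differentiable (at x)"
  shows "deriv_at (\<lambda>x. B (f x) (g x)) x v = B (f x) (deriv_at g x v) + B (deriv_at f x v) (g x)"
  by (rule deriv_at_eq[OF bounded_bilinear.FDERIV[OF assms(1)
        has_derivative_deriv_at[OF assms(2)] has_derivative_deriv_at[OF assms(3)]]])

lemma differentiable_bilinear:
  assumes "bounded_bilinear B" "f differentiable (at x)" "g differentiable (at x)"
  shows "(\<lambda>x. B (f x) (g x)) differentiable (at x)"
  using bounded_bilinear.FDERIV[OF assms(1)
        has_derivative_deriv_at[OF assms(2)] has_derivative_deriv_at[OF assms(3)]]
  by (rule differentiableI)

lemma Ck_on_linear:
  assumes "open S" "bounded_linear L" "Ck_on k S f"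
  shows "Ck_on k S (\<lambda>x. L (f x))"
  using assms(3)
proof (induction k arbitrary: f)
  case 0
  then show ?case using bounded_linear.continuous_on[OF assms(2)] by auto
next
  case (Suc k)
  have "Ck_on k S (\<lambda>x. deriv_at (\<lambda>x. L (f x)) x v)" for v
  proof (rule Ck_on_cong[OF \<open>open S\<close>])
    show "Ck_on k S (\<lambda>x. L (deriv_at f x v))"
      by (rule Suc.IH) (use Suc.prems in simp)
  qed (rule deriv_at_linear[symmetric, OF assms(2)], use Suc.prems in simp)
  then show ?case
    unfolding Ck_on.simps using Suc.prems by (intro conjI ballI allI differentiable_linear[OF assms(2)]) simp_all
qed

lemma Ck_on_bilinear:
  assumes "open S" "bounded_bilinear B" "Ck_on k S f" "Ck_on k S g"
  shows "Ck_on k S (\<lambda>x. B (f x) (g x))"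
  using assms(3,4)
proof (induction k arbitrary: f g)
  case 0
  then show ?case using bounded_bilinear.continuous_on[OF assms(2)] by auto
next
  case (Suc k)
  have "Ck_on k S (\<lambda>x. deriv_at (\<lambda>x. B (f x) (g x)) x v)" for v
  proof (rule Ck_on_cong[OF \<open>open S\<close>])
    show "Ck_on k S (\<lambda>x. B (f x) (deriv_at g x v) + B (deriv_at f x v) (g x))"
      using Suc.prems Ck_on_SucD[OF Suc.prems(1)] Ck_on_SucD[OF Suc.prems(2)]
      by (intro Ck_on_add \<open>open S\<close> Suc.IH) simp_all
  qed (rule deriv_at_bilinear[symmetric, OF assms(2)], use Suc.prems in simp_all)
  then show ?case
    unfolding Ck_on.simps using Suc.prems by (intro conjI ballI allI differentiable_bilinear[OF assms(2)]) simp_all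
qed

lemma smooth_on_differentiable: "smooth_on S f \<Longrightarrow> x \<in> S \<Longrightarrow> f differentiable (at x)"
  unfolding smooth_on_def by (metis Ck_on.simps(2))

lemma smooth_on_deriv: "smooth_on S f \<Longrightarrow> smooth_on S (\<lambda>x. deriv_at f x v)"
  unfolding smooth_on_def by (metis Ck_on.simps(2))

lemma smooth_on_linear: "open S \<Longrightarrow> bounded_linear L \<Longrightarrow> smooth_on S f \<Longrightarrow> smooth_on S (\<lambda>x. L (f x))"
  unfolding smooth_on_def by (blast intro: Ck_on_linear)

lemma smooth_on_bilinear:
  "open S \<Longrightarrow> bounded_bilinear B \<Longrightarrow> smooth_on S f \<Longrightarrow> smooth_on S g \<Longrightarrow> smooth_on S (\<lambda>x. B (f x) (g x))"
  unfolding smooth_on_def by (blast intro: Ck_on_bilinear)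

lemma Ck_on_const: "Ck_on k S (\<lambda>x. c)"
  by (induction k arbitrary: c) auto

lemma smooth_on_bounded_linear:
  assumes "bounded_linear L"
  shows "smooth_on S L"
proof -
  have "Ck_on k S L" for k
    using deriv_at_eq[OF bounded_linear_imp_has_derivative[OF assms]]
    by (cases k) (auto simp: Ck_on_const linear_continuous_on[OF assms] bounded_linear_imp_differentiable[OF assms])
  then show ?thesis by (simp add: smooth_on_def)
qed

lemma directional_mvt:
  fixes f :: "'a::real_normed_vector \<Rightarrow> real"
  assumes "h > 0" "\<And>t. 0 \<le> t \<Longrightarrow> t \<le> h \<Longrightarrow> f differentiable (at (x + t *\<^sub>R v))"
  shows "\<exists>t. 0 < t \<and> t < h \<and> f (x + h *\<^sub>R v) - f x = h * deriv_at f (x + t *\<^sub>R v) v"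
proof -
  have "((\<lambda>t. f (x + t *\<^sub>R v)) has_derivative (\<lambda>s. s * deriv_at f (x + t *\<^sub>R v) v)) (at t within {0..h})"
    if "0 \<le> t" "t \<le> h" for t
  proof -
    note d = has_derivative_deriv_at[OF assms(2)[OF that]]
    have "((\<lambda>t. f (x + t *\<^sub>R v)) has_derivative (\<lambda>s. deriv_at f (x + t *\<^sub>R v) (s *\<^sub>R v))) (at t)"
      by (rule has_derivative_compose[where g=f and f="\<lambda>t. x + t *\<^sub>R v", OF _ d])
         (auto intro!: derivative_eq_intros)
    then show ?thesis
      by (simp add: has_derivative_at_withinI linear_cmul[OF has_derivative_linear[OF d]])
  qed
  from mvt_simple[OF \<open>h > 0\<close> this] show ?thesis by fastforce
qed

text \<open>The second difference is symmetric in \<open>v\<close> and \<open>w\<close>. The mean value theorem along \<open>v\<close> and then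
  along \<open>w\<close> turns it into one of the two mixed second derivatives, at some nearby point; after an exchange of
  \<open>v\<close> and \<open>w\<close> it gives the other one.\<close>

lemma second_difference_mvt:
  fixes f :: "'a::real_normed_vector \<Rightarrow> real"
  assumes C2: "Ck_on 2 S f" and r: "ball x r \<subseteq> S" and h: "h > 0" "h * (norm v + norm w) < r"
  shows "\<exists>y\<in>ball x r. f (x + h *\<^sub>R v + h *\<^sub>R w) - f (x + h *\<^sub>R v) - f (x + h *\<^sub>R w) + f x
           = h^2 * deriv_at (\<lambda>z. deriv_at f z v) y w"
proof -
  have df: "f differentiable (at y)" and ddf: "(\<lambda>z. deriv_at f z v) differentiable (at y)" if "y \<in> ball x r" for y
    using C2 r that by (auto simp: numeral_2_eq_2)
  have inb: "x + s *\<^sub>R v + t *\<^sub>R w \<in> ball x r" if "0 \<le> s" "s \<le> h" "0 \<le> t" "t \<le> h" for s t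
  proof -
    have "norm (s *\<^sub>R v + t *\<^sub>R w) \<le> s * norm v + t * norm w"
      using that by (metis abs_of_nonneg norm_scaleR norm_triangle_ineq)
    also have "\<dots> \<le> h * (norm v + norm w)"
      using that by (simp add: distrib_left add_mono mult_right_mono)
    also have "\<dots> < r" by (rule h(2))
    finally have "norm (- (s *\<^sub>R v + t *\<^sub>R w)) < r" by (simp only: norm_minus_cancel)
    moreover have "x - (x + s *\<^sub>R v + t *\<^sub>R w) = - (s *\<^sub>R v + t *\<^sub>R w)" by simp
    ultimately show ?thesis by (simp only: mem_ball dist_norm)
  qed
  define g where "g = (\<lambda>z. f (z + h *\<^sub>R w) - f z)"
  have dg: "(g has_derivative (\<lambda>u. deriv_at f (x + s *\<^sub>R v + h *\<^sub>R w) u - deriv_at f (x + s *\<^sub>R v) u)) (at (x + s *\<^sub>R v))"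
    if "0 \<le> s" "s \<le> h" for s
  proof -
    have "((\<lambda>z. f (z + h *\<^sub>R w)) has_derivative (\<lambda>u. deriv_at f (x + s *\<^sub>R v + h *\<^sub>R w) u)) (at (x + s *\<^sub>R v))"
      by (rule has_derivative_compose[where g=f and f="\<lambda>z. z + h *\<^sub>R w"])
         (use inb[of s h] that h in \<open>auto intro!: derivative_eq_intros has_derivative_deriv_at df\<close>)
    then show ?thesis unfolding g_def
      by (rule has_derivative_diff) (use inb[of s 0] that h in \<open>auto intro!: has_derivative_deriv_at df\<close>)
  qed
  obtain s where s: "0 < s" "s < h" "g (x + h *\<^sub>R v) - g x = h * deriv_at g (x + s *\<^sub>R v) v"
    using directional_mvt[OF h(1), of g x v] dg by (auto simp: differentiable_def)
  obtain t where t: "0 < t" "t < h"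
     "deriv_at f (x + s *\<^sub>R v + h *\<^sub>R w) v - deriv_at f (x + s *\<^sub>R v) v
       = h * deriv_at (\<lambda>z. deriv_at f z v) (x + s *\<^sub>R v + t *\<^sub>R w) w"
    using directional_mvt[OF h(1), of "\<lambda>z. deriv_at f z v" "x + s *\<^sub>R v" w] ddf inb s by fastforce
  have "g (x + h *\<^sub>R v) - g x = h^2 * deriv_at (\<lambda>z. deriv_at f z v) (x + s *\<^sub>R v + t *\<^sub>R w) w"
    using s t deriv_at_eq[OF dg, of s v] by (simp add: power2_eq_square)
  then show ?thesis using inb[of s t] s t by (auto simp: g_def intro!: bexI)
qed

text \<open>By the previous lemma the two mixed derivatives, both continuous, take equal values at points
  arbitrarily close to \<open>x\<close>.\<close>

lemma symmetric_second_derivative_real: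
  fixes f :: "'a::real_normed_vector \<Rightarrow> real"
  assumes "open S" "Ck_on 2 S f" "x \<in> S"
  shows "deriv_at (\<lambda>z. deriv_at f z v) x w = deriv_at (\<lambda>z. deriv_at f z w) x v"
proof (rule ccontr)
  define P where "P = (\<lambda>y. deriv_at (\<lambda>z. deriv_at f z v) y w)"
  define Q where "Q = (\<lambda>y. deriv_at (\<lambda>z. deriv_at f z w) y v)"
  assume "\<not> ?thesis"
  then have e: "dist (P x) (Q x) / 2 > 0" by (simp add: P_def Q_def)
  have "continuous_on S P" "continuous_on S Q"
    using assms(2) by (auto simp: P_def Q_def numeral_2_eq_2)
  then have "(P \<longlongrightarrow> P x) (nhds x)" "(Q \<longlongrightarrow> Q x) (nhds x)"
    using assms by (auto simp: continuous_on_eq_continuous_at isCont_def tendsto_at_iff_tendsto_nhds)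
  then have "\<forall>\<^sub>F y in nhds x. y \<in> S \<and> dist (P y) (P x) < dist (P x) (Q x) / 2 \<and> dist (Q y) (Q x) < dist (P x) (Q x) / 2"
    using e assms by (intro eventually_conj eventually_nhds_in_open tendstoD[OF _ e]) simp_all
  then obtain r where r: "r > 0" "\<And>y. y \<in> ball x r \<Longrightarrow> y \<in> S" 
      "\<And>y. y \<in> ball x r \<Longrightarrow> dist (P y) (P x) < dist (P x) (Q x) / 2"
      "\<And>y. y \<in> ball x r \<Longrightarrow> dist (Q y) (Q x) < dist (P x) (Q x) / 2"
    by (auto simp: eventually_nhds_metric dist_commute)
  \<comment> \<open>any step with \<open>h (\<bar>v\<bar> + \<bar>w\<bar>) < r\<close> keeps the second difference inside the ball\<close>
  define h where "h = r / (norm v + norm w + 1)"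
  have h: "h > 0" "h * (norm v + norm w) < r"
  proof -
    have n: "norm v + norm w + 1 > 0" by (smt (verit) norm_ge_zero)
    show "h > 0" using n r by (simp add: h_def)
    have "h * (norm v + norm w) = r - h" using n by (simp add: h_def field_simps)
    then show "h * (norm v + norm w) < r" using \<open>h > 0\<close> by simp
  qed
  have hwv: "h * (norm w + norm v) < r" using h(2) by (simp add: add.commute)
  obtain y where y: "y \<in> ball x r" 
     "f (x + h *\<^sub>R v + h *\<^sub>R w) - f (x + h *\<^sub>R v) - f (x + h *\<^sub>R w) + f x = h^2 * P y"
    using second_difference_mvt[OF assms(2) _ h] r(2) unfolding P_def by blast
  obtain y' where y': "y' \<in> ball x r" 
     "f (x + h *\<^sub>R w + h *\<^sub>R v) - f (x + h *\<^sub>R w) - f (x + h *\<^sub>R v) + f x = h^2 * Q y'"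
    using second_difference_mvt[OF assms(2) _ h(1) hwv] r(2) unfolding Q_def by blast
  have "h^2 * P y = h^2 * Q y'"
    using y(2) y'(2) by (simp add: algebra_simps)
  then have "P y = Q y'" using h by simp
  then show False using r(3)[OF y(1)] r(4)[OF y'(1)] e
    by (metis dist_commute dist_triangle_half_r less_irrefl)
qed

lemma symmetric_second_derivative:
  fixes f :: "'a::real_normed_vector \<Rightarrow> 'b::euclidean_space"
  assumes "open S" "smooth_on S f" "x \<in> S"
  shows "deriv_at (\<lambda>z. deriv_at f z v) x w = deriv_at (\<lambda>z. deriv_at f z w) x v"
proof (rule euclidean_eqI)
  fix b :: 'b assume "b \<in> Basis"
  have L: "bounded_linear (\<lambda>y. y \<bullet> b)" by (rule bounded_linear_inner_left)
  have eq: "deriv_at (\<lambda>z. deriv_at f z v) x w \<bullet> b = deriv_at (\<lambda>z. deriv_at (\<lambda>z. f z \<bullet> b) z v) x w" for v w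
  proof -
    have d: "(\<lambda>z. deriv_at f z v) differentiable (at x)"
      by (rule smooth_on_differentiable[OF smooth_on_deriv[OF assms(2)] assms(3)])
    have "deriv_at (\<lambda>z. deriv_at f z v \<bullet> b) x = deriv_at (\<lambda>z. deriv_at (\<lambda>z. f z \<bullet> b) z v) x"
      by (rule frechet_derivative_transform_within_open[OF differentiable_linear[OF L d] assms(1,3)])
         (simp add: deriv_at_linear[OF L smooth_on_differentiable[OF assms(2)]])
    then show ?thesis using deriv_at_linear[OF L d, of w] by simp
  qed
  have "Ck_on 2 S (\<lambda>z. f z \<bullet> b)"
    using smooth_on_linear[OF assms(1) L assms(2)] by (simp add: smooth_on_def)
  from symmetric_second_derivative_real[OF assms(1) this assms(3)]
  show "deriv_at (\<lambda>z. deriv_at f z v) x w \<bullet> b = deriv_at (\<lambda>z. deriv_at f z w) x v \<bullet> b"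
    by (simp add: eq)
qed

section \<open>The algebra of pairs of matrices\<close>

text \<open>The adjugate of a \<open>2 \<times> 2\<close> matrix. On \<open>SL(2,\<real>)\<close> it is the inverse, but unlike the inverse it is linear,
  which keeps all derivatives below elementary.\<close>

definition adj2 :: "mat2 \<Rightarrow> mat2" where
  "adj2 A = trace A *\<^sub>R mat 1 - A"

definition commut :: "mat2 \<Rightarrow> mat2 \<Rightarrow> mat2" where
  "commut a b = a ** b - b ** a"

definition pmul :: "mat2 \<times> mat2 \<Rightarrow> mat2 \<times> mat2 \<Rightarrow> mat2 \<times> mat2" where
  "pmul x y = (fst x ** fst y, snd x ** snd y)"

definition padj :: "mat2 \<times> mat2 \<Rightarrow> mat2 \<times> mat2" where
  "padj x = (adj2 (fst x), adj2 (snd x))"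

abbreviation pone :: "mat2 \<times> mat2" where "pone \<equiv> (mat 1, mat 1)"

abbreviation sl2_pairs :: "(mat2 \<times> mat2) set" where "sl2_pairs \<equiv> sl2 \<times> sl2"

lemmas mat2_simps = vec_eq_iff forall_2 matrix_matrix_mult_def sum_2 trace_def det_2 mat_def

lemma bounded_bilinearI:
  fixes B :: "'a::euclidean_space \<Rightarrow> 'b::euclidean_space \<Rightarrow> 'c::real_normed_vector"
  assumes "\<And>x y z. B (x + y) z = B x z + B y z" "\<And>x y z. B x (y + z) = B x y + B x z"
    "\<And>r x y. B (r *\<^sub>R x) y = r *\<^sub>R B x y" "\<And>r x y. B x (r *\<^sub>R y) = r *\<^sub>R B x y"
  shows "bounded_bilinear B"
  unfolding bilinear_conv_bounded_bilinear[symmetric]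
  by (auto simp: bilinear_def assms intro!: linearI)

lemma bounded_bilinear_mult: "bounded_bilinear ((**) :: mat2 \<Rightarrow> mat2 \<Rightarrow> mat2)"
  by (rule bounded_bilinearI) (simp_all add: mat2_simps algebra_simps)

lemma bounded_bilinear_pmul: "bounded_bilinear pmul"
  by (rule bounded_bilinearI) (simp_all add: pmul_def mat2_simps algebra_simps)

lemma bounded_bilinear_commut: "bounded_bilinear commut"
  by (rule bounded_bilinearI) (simp_all add: commut_def mat2_simps algebra_simps)

lemma bounded_bilinear_sl2_form: "bounded_bilinear sl2_form"
  by (rule bounded_bilinearI) (simp_all add: sl2_form_def mat2_simps algebra_simps)

interpretation mult: bounded_bilinear "(**) :: mat2 \<Rightarrow> mat2 \<Rightarrow> mat2" by (rule bounded_bilinear_mult)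
interpretation pmul: bounded_bilinear pmul by (rule bounded_bilinear_pmul)
interpretation commut: bounded_bilinear commut by (rule bounded_bilinear_commut)
interpretation sl2_form: bounded_bilinear sl2_form by (rule bounded_bilinear_sl2_form)

lemma bounded_linear_adj2: "bounded_linear adj2"
  unfolding linear_conv_bounded_linear[symmetric]
  by (rule linearI) (simp_all add: adj2_def mat2_simps algebra_simps)

lemma bounded_linear_padj: "bounded_linear padj"
  unfolding padj_def
  by (intro bounded_linear_Pair bounded_linear_compose[OF bounded_linear_adj2]
      bounded_linear_fst bounded_linear_snd)

lemma adj2_mult: "adj2 (A ** B) = adj2 B ** adj2 A"
  by (simp add: adj2_def mat2_simps algebra_simps)

lemma mult_adj2: "A ** adj2 A = det A *\<^sub>R mat 1" and adj2_mult_self: "adj2 A ** A = det A *\<^sub>R mat 1"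
  by (simp_all add: adj2_def mat2_simps algebra_simps)

lemma det_adj2: "det (adj2 A) = det A"
  by (simp add: adj2_def mat2_simps algebra_simps)

lemma adj2_sl2: "a \<in> sl2 \<Longrightarrow> adj2 a = - a"
  by (simp add: adj2_def sl2_def)

lemma pmul_assoc: "pmul (pmul x y) z = pmul x (pmul y z)"
  by (simp add: pmul_def matrix_mul_assoc)

lemma pmul_one [simp]: "pmul pone x = x" "pmul x pone = x"
  by (simp_all add: pmul_def)

lemma padj_pmul: "padj (pmul x y) = pmul (padj y) (padj x)"
  by (simp add: padj_def pmul_def adj2_mult)

lemma pmul_padj: "p \<in> SLSL \<Longrightarrow> pmul p (padj p) = pone" 
  and padj_pmul_self: "p \<in> SLSL \<Longrightarrow> pmul (padj p) p = pone"
  by (auto simp: SLSL_def SL2_def padj_def pmul_def mult_adj2 adj2_mult_self)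

lemma pmul_padj_cancel: "p \<in> SLSL \<Longrightarrow> pmul p (pmul (padj p) v) = v"
  and padj_pmul_cancel: "p \<in> SLSL \<Longrightarrow> pmul (padj p) (pmul p v) = v"
  by (simp_all add: pmul_assoc[symmetric] pmul_padj padj_pmul_self)

text \<open>Left multiplication by \<open>padj p\<close> trivialises the tangent space at \<open>p\<close>; the minus sign here is the one that appears when
  the trivialisation itself is differentiated.\<close>

lemma padj_sl2_pairs: "x \<in> sl2_pairs \<Longrightarrow> padj x = - x"
  by (auto simp: padj_def adj2_sl2 prod_eq_iff)

lemma matrix_inv_adj2:
  assumes "det A \<noteq> 0"
  shows "matrix_inv A = (1 / det A) *\<^sub>R adj2 A"
proof -
  let ?B = "(1 / det A) *\<^sub>R adj2 A"
  have B: "A ** ?B = mat 1" "?B ** A = mat 1"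
    using assms by (simp_all add: mult.scaleR_left mult.scaleR_right mult_adj2 adj2_mult_self)
  then have "A ** matrix_inv A = mat 1"
    unfolding matrix_inv_def by (metis (mono_tags, lifting) someI_ex)
  then have "?B ** (A ** matrix_inv A) = ?B" by simp
  then show ?thesis by (simp add: matrix_mul_assoc B)
qed

section \<open>The geometry in the left trivialisation\<close>

definition gform :: "mat2 \<times> mat2 \<Rightarrow> mat2 \<times> mat2 \<Rightarrow> real" where
  "gform x y = 2 / 3 * (sl2_form (fst x) (fst y) + sl2_form (snd x) (snd y))
             - 1 / 3 * (sl2_form (snd x) (fst y) + sl2_form (fst x) (snd y))"

definition Jform :: "mat2 \<times> mat2 \<Rightarrow> mat2 \<times> mat2" where
  "Jform x = (1 / sqrt 3) *\<^sub>R (fst x - 2 *\<^sub>R snd x, 2 *\<^sub>R fst x - snd x)"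

definition pbr :: "mat2 \<times> mat2 \<Rightarrow> mat2 \<times> mat2 \<Rightarrow> mat2 \<times> mat2" where
  "pbr x y = (commut (fst x) (fst y), commut (snd x) (snd y))"

text \<open>The value, in the left trivialisation, of \<open>\<nabla>\<^sub>x y\<close> for left-invariant fields, as the Koszul formula gives it:
  half the Lie bracket, plus a symmetric part that is caused by the mixed terms of \<open>g\<close>.\<close>

definition conn :: "mat2 \<times> mat2 \<Rightarrow> mat2 \<times> mat2 \<Rightarrow> mat2 \<times> mat2" where
  "conn x y = (1 / 2) *\<^sub>R pbr x y
     + (1 / 6) *\<^sub>R (- (commut (fst x) (snd y) + commut (fst y) (snd x)),
                   commut (fst x) (snd y) + commut (fst y) (snd x))"

lemma bounded_bilinear_gform: "bounded_bilinear gform"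
  by (rule bounded_bilinearI)
     (simp_all add: gform_def sl2_form.add_left sl2_form.add_right sl2_form.scaleR_left
       sl2_form.scaleR_right algebra_simps)

interpretation gform: bounded_bilinear gform by (rule bounded_bilinear_gform)

lemma bounded_bilinear_conn: "bounded_bilinear conn"
  by (rule bounded_bilinearI)
     (simp_all add: conn_def pbr_def prod_eq_iff commut.add_left commut.add_right commut.scaleR_left
       commut.scaleR_right algebra_simps)

interpretation conn: bounded_bilinear conn by (rule bounded_bilinear_conn)

lemma pbr_eq: "pbr x y = pmul x y - pmul y x"
  by (simp add: pbr_def pmul_def commut_def prod_eq_iff)

lemma sl2_form_commute: "sl2_form a b = sl2_form b a"
  unfolding sl2_form_def by (subst trace_mul_sym) (rule refl)

lemma gform_commute: "gform x y = gform y x"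
  by (simp add: gform_def sl2_form_commute)

text \<open>Invariance of the trace form under the adjoint action.\<close>

lemma sl2_form_commut: "sl2_form b (commut a c) = - sl2_form (commut a b) c"
  by (simp add: sl2_form_def commut_def mat2_simps algebra_simps)

lemma commut_anti: "commut a b = - commut b a"
  by (simp add: commut_def)

lemma conn_torsion: "conn x y - conn y x = pbr x y"
  by (simp add: conn_def pbr_def prod_eq_iff commut_anti[of "fst y" "fst x"]
      commut_anti[of "snd y" "snd x"] algebra_simps scaleR_add_left[symmetric])

lemma conn_metric: "gform (conn x y) z + gform y (conn x z) = 0"
  by (simp add: gform_def conn_def pbr_def commut_anti[of "fst y" "snd x"] commut_anti[of "fst z" "snd x"]
      sl2_form.add_left sl2_form.add_right sl2_form.scaleR_left sl2_form.scaleR_right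
      sl2_form.minus_left sl2_form.minus_right sl2_form.diff_left sl2_form.diff_right
      sl2_form_commut) (simp add: field_simps)

lemma subspace_sl2: "subspace sl2"
  by (auto simp: subspace_def sl2_def mat2_simps algebra_simps simp flip: distrib_left)

lemma subspace_sl2_pairs: "subspace sl2_pairs"
  by (rule subspace_Times[OF subspace_sl2 subspace_sl2])

text \<open>In this form the derivative of a map with trace-free values is seen to be trace-free: a linear map
  commutes with differentiation.\<close>

lemma sl2_pairs_kernel: "\<exists>L::mat2 \<times> mat2 \<Rightarrow> real \<times> real. bounded_linear L \<and> (\<forall>x. L x = 0 \<longleftrightarrow> x \<in> sl2_pairs)"
proof (intro exI conjI)
  let ?L = "\<lambda>x::mat2 \<times> mat2. (trace (fst x), trace (snd x))"
  show "bounded_linear ?L"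
    unfolding linear_conv_bounded_linear[symmetric]
    by (rule linearI) (simp_all add: trace_def sum_2 algebra_simps)
  show "\<forall>x. ?L x = 0 \<longleftrightarrow> x \<in> sl2_pairs"
    by (simp add: sl2_def mem_Times_iff zero_prod_def)
qed

lemma commut_sl2: "commut a b \<in> sl2"
  by (simp add: sl2_def commut_def mat2_simps)

lemma conn_sl2_pairs: "conn x y \<in> sl2_pairs"
  unfolding conn_def pbr_def
  by (auto intro!: subspace_add[OF subspace_sl2] subspace_scale[OF subspace_sl2]
      subspace_diff[OF subspace_sl2] subspace_neg[OF subspace_sl2] commut_sl2)

lemma metric_g_gform:
  "p \<in> SLSL \<Longrightarrow> metric_g p v w = gform (pmul (padj p) v) (pmul (padj p) w)"
  by (auto simp: metric_g_def Let_def gform_def pmul_def padj_def SLSL_def SL2_def matrix_inv_adj2)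

lemma complex_J_Jform: "p \<in> SLSL \<Longrightarrow> complex_J p v = pmul p (Jform (pmul (padj p) v))"
  by (auto simp: complex_J_def Let_def Jform_def pmul_def padj_def SLSL_def SL2_def matrix_inv_adj2
      mult.scaleR_right)

text \<open>Multiplication by \<open>p\<close> and by \<open>padj p\<close> are inverse to each other, so tangency is a condition on the
  trivialised vector alone.\<close>

lemma tangent_space_iff: "p \<in> SLSL \<Longrightarrow> v \<in> tangent_space p \<longleftrightarrow> pmul (padj p) v \<in> sl2_pairs"
proof -
  assume p: "p \<in> SLSL"
  have "v \<in> tangent_space p \<longleftrightarrow> (\<exists>x\<in>sl2_pairs. v = pmul p x)"
    by (auto simp: tangent_space_def pmul_def)
  then show ?thesis
    using pmul_padj_cancel[OF p] padj_pmul_cancel[OF p] by metis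
qed

text \<open>The curvature tensor \<open>R(x, y)z\<close> of \<open>g\<close> in the left trivialisation, where \<open>conn\<close> has constant coefficients.\<close>

definition curv :: "mat2 \<times> mat2 \<Rightarrow> mat2 \<times> mat2 \<Rightarrow> mat2 \<times> mat2 \<Rightarrow> mat2 \<times> mat2" where
  "curv x y z = conn x (conn y z) - conn y (conn x z) - conn (pbr x y) z"

text \<open>Each \<open>conn x\<close> is skew with respect to \<open>gform\<close>, hence so are their commutators.\<close>

lemma curv_skew: "gform (curv x y z) z = 0"
proof -
  have 1: "gform (conn a z) z = 0" for a
    using conn_metric[of a z z] by (simp add: gform_commute)
  have "gform (conn x (conn y z)) z = - gform (conn y z) (conn x z)"
    using conn_metric[of x "conn y z" z] by simp
  moreover have "gform (conn y (conn x z)) z = - gform (conn x z) (conn y z)"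
    using conn_metric[of y "conn x z" z] by simp
  ultimately show ?thesis
    using gform_commute[of "conn x z" "conn y z"] by (simp add: curv_def gform.diff_left 1)
qed

text \<open>On a \<open>J\<close>-invariant plane the curvature is governed by the double commutators of the two components. With
  \<open>k = [a,b]\<close>, all terms of \<open>curv\<close> are combinations of \<open>[k,a]\<close> and \<open>[k,b]\<close>.\<close>

lemma curv_J:
  "curv (Jform (a, b)) (a, b) (a, b)
     = (- 2 / (3 * sqrt 3)) *\<^sub>R (commut (commut a b) a, commut (commut a b) b)"
proof -
  define k where "k = commut a b"
  define x where "x = (a, b)"
  define y where "y = (a - 2 *\<^sub>R b, 2 *\<^sub>R a - b)"
  have self: "commut c c = 0" for c by (simp add: commut_def)
  note ex = commut.add_left commut.add_right commut.scaleR_left commut.scaleR_right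
      commut.minus_left commut.minus_right commut.diff_left commut.diff_right self
      commut_anti[of b a] k_def[symmetric] commut_anti[of a k] commut_anti[of b k]
  have J: "Jform x = (1 / sqrt 3) *\<^sub>R y" by (simp add: Jform_def x_def y_def)
  have pb: "pbr y x = (2 *\<^sub>R k, 2 *\<^sub>R k)"
    by (simp add: pbr_def x_def y_def ex)
  have xx: "conn x x = (1 / 3) *\<^sub>R (- k, k)"
    by (simp add: conn_def pbr_def x_def ex)
  have yx: "conn y x = (k, k)"
    by (simp add: conn_def pbr_def x_def y_def ex)
  have "curv y x x = (1 / 3) *\<^sub>R conn y (- k, k) - conn x (k, k) - conn (2 *\<^sub>R k, 2 *\<^sub>R k) x"
    by (simp only: curv_def pb xx yx conn.scaleR_right)
  also have "\<dots> = (- 2 / 3) *\<^sub>R (commut k a, commut k b)"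
    by (simp add: conn_def pbr_def x_def y_def ex) (simp add: vec_eq_iff field_simps)
  finally have "curv y x x = (- 2 / 3) *\<^sub>R (commut k a, commut k b)" .
  moreover have "curv (Jform x) x x = (1 / sqrt 3) *\<^sub>R curv y x x"
    by (simp only: J curv_def pbr_def commut.scaleR_left conn.scaleR_left conn.scaleR_right fst_scaleR
        snd_scaleR scaleR_diff_right scaleR_Pair[symmetric])
  ultimately show ?thesis by (simp add: x_def k_def)
qed

text \<open>By Cayley-Hamilton, trace-free matrices satisfy \<open>ab + ba = 2\<langle>a,b\<rangle>\<close> times the identity; this removes every product
  of three factors.\<close>

lemma commut_commut:
  assumes "a \<in> sl2" "b \<in> sl2"
  shows "commut (commut a b) a = 4 *\<^sub>R (sl2_form a b *\<^sub>R a - sl2_form a a *\<^sub>R b)"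
    "commut (commut a b) b = 4 *\<^sub>R (sl2_form b b *\<^sub>R a - sl2_form a b *\<^sub>R b)"
proof -
  have *: "a $ 2 $ 2 = - a $ 1 $ 1" "b $ 2 $ 2 = - b $ 1 $ 1"
    using assms by (auto simp: sl2_def trace_def sum_2)
  show "commut (commut a b) a = 4 *\<^sub>R (sl2_form a b *\<^sub>R a - sl2_form a a *\<^sub>R b)"
    "commut (commut a b) b = 4 *\<^sub>R (sl2_form b b *\<^sub>R a - sl2_form a b *\<^sub>R b)"
    by (simp_all add: commut_def sl2_form_def mat2_simps * algebra_simps)
qed

text \<open>The centraliser of a nonzero element of \<open>sl(2,\<real>)\<close> is the line that it spans: \<open>[a,b]\<close> is, up to scaling of the entries, the
  cross product of the coordinate vectors.\<close>

lemma commut_eq_0D: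
  assumes "a \<in> sl2" "b \<in> sl2" "commut a b = 0" "a \<noteq> 0"
  shows "\<exists>t. b = t *\<^sub>R a"
proof -
  have *: "a $ 2 $ 2 = - a $ 1 $ 1" "b $ 2 $ 2 = - b $ 1 $ 1"
    using assms by (auto simp: sl2_def trace_def sum_2)
  have c: "a$1$2 * b$2$1 = b$1$2 * a$2$1" "a$1$1 * b$1$2 = b$1$1 * a$1$2" "a$2$1 * b$1$1 = b$2$1 * a$1$1"
  proof -
    have "commut a b $ 1 $ 1 = a$1$2 * b$2$1 - b$1$2 * a$2$1"
      "commut a b $ 1 $ 2 = 2 * (a$1$1 * b$1$2 - b$1$1 * a$1$2)"
      "commut a b $ 2 $ 1 = 2 * (a$2$1 * b$1$1 - b$2$1 * a$1$1)"
      by (simp_all add: commut_def matrix_matrix_mult_def sum_2 * algebra_simps)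
    then show "a$1$2 * b$2$1 = b$1$2 * a$2$1" "a$1$1 * b$1$2 = b$1$1 * a$1$2" "a$2$1 * b$1$1 = b$2$1 * a$1$1"
      using assms(3) by simp_all
  qed
  from \<open>a \<noteq> 0\<close> consider "a$1$1 \<noteq> 0" | "a$1$2 \<noteq> 0" | "a$2$1 \<noteq> 0"
    by (auto simp: mat2_simps *)
  then show ?thesis
  proof cases
    case 1
    then show ?thesis using c
      by (intro exI[of _ "b$1$1 / a$1$1"]) (simp add: mat2_simps * field_simps)
  next
    case 2
    then show ?thesis using c
      by (intro exI[of _ "b$1$2 / a$1$2"]) (simp add: mat2_simps * field_simps)
  next
    case 3
    then show ?thesis using c
      by (intro exI[of _ "b$2$1 / a$2$1"]) (simp add: mat2_simps * field_simps)
  qed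
qed

text \<open>If \<open>a\<close> and \<open>b\<close> were independent, then \<open>commut_commut\<close> would make \<open>\<langle>a,a\<rangle>\<close>, \<open>\<langle>a,b\<rangle>\<close> and \<open>\<langle>b,b\<rangle>\<close> all zero,
  against positivity.\<close>

lemma curv_J_zero_imp_commut:
  assumes "(a, b) \<in> sl2_pairs" "gform (a, b) (a, b) > 0" "curv (Jform (a, b)) (a, b) (a, b) = 0"
  shows "commut a b = 0"
proof (rule ccontr)
  assume k: "commut a b \<noteq> 0"
  have *: "commut (commut a b) a = 0" "commut (commut a b) b = 0"
    using assms(3) by (auto simp: curv_J zero_prod_def)
  have ab: "a \<in> sl2" "b \<in> sl2" using assms(1) by auto
  have nz: "a \<noteq> 0" "b \<noteq> 0" using k by (auto simp: commut_def)
  have 1: "sl2_form a b *\<^sub>R a = sl2_form a a *\<^sub>R b" "sl2_form b b *\<^sub>R a = sl2_form a b *\<^sub>R b"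
    using * commut_commut[OF ab] by auto
  have np: "b \<noteq> t *\<^sub>R a" for t
    using k by (auto simp: commut_def mult.scaleR_left mult.scaleR_right)
  have "sl2_form a a = 0"
    using 1(1) np[of "inverse (sl2_form a a) * sl2_form a b"]
    by (metis left_inverse scaleR_one scaleR_scaleR)
  moreover from this have "sl2_form a b = 0" using 1(1) nz by auto
  moreover from this have "sl2_form b b = 0" using 1(2) nz by auto
  ultimately show False using assms(2) by (simp add: gform_def sl2_form_commute[of b a])
qed

lemma gform_Jform: "gform (Jform x) (Jform x) = gform x x" "gform x (Jform x) = 0"
proof -
  have s3: "sqrt 3 * (sqrt 3 * t) = (3::real) * t" for t
    by (simp add: mult.assoc[symmetric])
  show "gform (Jform x) (Jform x) = gform x x" "gform x (Jform x) = 0"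
    by (simp_all add: Jform_def gform_def sl2_form.diff_left sl2_form.diff_right sl2_form.scaleR_left
     sl2_form.scaleR_right sl2_form_commute[of "snd x" "fst x"] field_simps s3)
qed

text \<open>Pairing a matrix with its transpose gives half the sum of the squares of its entries. The mixed terms of
  \<open>gform\<close> do no harm since the coefficient matrix \<open>(2,-1;-1,2)\<close> is invertible.\<close>

lemma gform_nondegenerate:
  assumes "x \<in> sl2_pairs" "\<And>y. y \<in> sl2_pairs \<Longrightarrow> gform x y = 0"
  shows "x = 0"
proof -
  have sl: "a = 0" if a: "a \<in> sl2" and o: "\<And>b. b \<in> sl2 \<Longrightarrow> sl2_form a b = 0" for a
  proof -
    have "transpose a \<in> sl2" using a by (simp add: sl2_def trace_def transpose_def)
    from o[OF this] have "(a$1$1)^2 + (a$1$2)^2 + ((a$2$1)^2 + (a$2$2)^2) = 0"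
      by (simp add: sl2_form_def mat2_simps transpose_def power2_eq_square)
    then have "(a$1$1)^2 + (a$1$2)^2 = 0 \<and> (a$2$1)^2 + (a$2$2)^2 = 0"
      by (smt (verit) zero_le_power2)
    then show "a = 0" unfolding sum_power2_eq_zero_iff by (simp add: vec_eq_iff forall_2)
  qed
  have z: "0 \<in> sl2" by (simp add: sl2_def trace_def)
  have e: "2 * sl2_form (fst x) b - sl2_form (snd x) b = 0"
    "2 * sl2_form (snd x) b - sl2_form (fst x) b = 0" if b: "b \<in> sl2" for b
    using assms(2)[of "(b, 0)"] assms(2)[of "(0, b)"] b z
    by (simp_all add: gform_def sl2_form.zero_right sl2_form.zero_left)
  have o: "sl2_form (fst x) b = 0" "sl2_form (snd x) b = 0" if b: "b \<in> sl2" for b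
    using e[OF b] by linarith+
  have "fst x \<in> sl2" "snd x \<in> sl2" using assms(1) by (simp_all add: mem_Times_iff)
  then have "fst x = 0" "snd x = 0" using sl[OF _ o(1)] sl[OF _ o(2)] by blast+
  then show ?thesis by (simp add: prod_eq_iff)
qed

section \<open>The Levi-Civita connection\<close>

text \<open>A field \<open>A\<gamma>\<close> differentiated along \<open>A\<alpha>\<close> in the vector space of matrices gives
  \<open>A\<alpha>\<gamma> + A\<gamma>'\<close>. The covariant derivative has \<open>conn\<close> in place of the product \<open>\<alpha>\<gamma>\<close>, which is therefore
  subtracted.\<close>

definition LC :: connection_form where
  "LC p v w = pmul p (conn (pmul (padj p) v) (pmul (padj p) w) - pmul (pmul (padj p) v) (pmul (padj p) w))"

lemma det_one_plus: "a \<in> sl2 \<Longrightarrow> det (mat 1 + t *\<^sub>R a) = 1 + t\<^sup>2 * det a"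
proof -
  assume "a \<in> sl2"
  then have *: "a $ 2 $ 2 = - a $ 1 $ 1" by (auto simp: sl2_def trace_def sum_2)
  show ?thesis by (simp add: mat2_simps * power2_eq_square algebra_simps)
qed

lemma det_scaleR2: "det (c *\<^sub>R a :: mat2) = c\<^sup>2 * det a"
  by (simp add: det_2 power2_eq_square algebra_simps)

text \<open>The line \<open>1 + ta\<close> has determinant \<open>1 + t\<^sup>2 det a\<close>, as \<open>a\<close> is trace-free; rescaling it to determinant \<open>1\<close>
  does not change its velocity at \<open>0\<close>.\<close>

lemma SL2_curve:
  assumes a: "a \<in> sl2"
  shows "\<exists>c::real \<Rightarrow> mat2. c 0 = mat 1 \<and> (c has_derivative (\<lambda>s. s *\<^sub>R a)) (at 0)
            \<and> (\<forall>\<^sub>F t in at 0. c t \<in> SL2)"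
proof (intro exI conjI)
  define c :: "real \<Rightarrow> mat2" where "c t = (1 / sqrt (1 + t\<^sup>2 * det a)) *\<^sub>R (mat 1 + t *\<^sub>R a)" for t
  show "c 0 = mat 1" by (simp add: c_def)
  show "(c has_derivative (\<lambda>s. s *\<^sub>R a)) (at 0)"
    unfolding c_def by (auto intro!: derivative_eq_intros)
  have "((\<lambda>t. 1 + t\<^sup>2 * det a) \<longlongrightarrow> 1 + 0\<^sup>2 * det a) (at 0)" by (intro tendsto_intros)
  then have "\<forall>\<^sub>F t in at 0. 1 + t\<^sup>2 * det a > 0"
    by (rule order_tendstoD) simp
  then show "\<forall>\<^sub>F t in at 0. c t \<in> SL2"
    by eventually_elim (simp add: c_def SL2_def det_scaleR2 det_one_plus[OF a] power_divide)
qed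

lemma SL2_mult: "A \<in> SL2 \<Longrightarrow> B \<in> SL2 \<Longrightarrow> A ** B \<in> SL2"
  by (simp add: SL2_def det_mul)

lemma SLSL_pmul: "p \<in> SLSL \<Longrightarrow> q \<in> SLSL \<Longrightarrow> pmul p q \<in> SLSL"
  by (auto simp: SLSL_def pmul_def SL2_mult)

text \<open>Every tangent vector is the velocity of a curve inside \<open>SLSL\<close>, along which \<open>h\<close> is constant. This is how
  statements about \<open>SLSL\<close> pass to derivatives of maps that are defined on all pairs of matrices.\<close>

lemma tangential_derivative_zero:
  assumes p: "p \<in> SLSL" and v: "v \<in> tangent_space p" and h: "h differentiable (at p)"
    and const: "\<And>q. q \<in> SLSL \<Longrightarrow> h q = k"
  shows "deriv_at h p v = 0"
proof -
  obtain a b where ab: "a \<in> sl2" "b \<in> sl2" "v = pmul p (a, b)"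
    using v by (auto simp: tangent_space_def pmul_def)
  obtain c where c: "c 0 = mat 1" "(c has_derivative (\<lambda>s. s *\<^sub>R a)) (at 0)" "\<forall>\<^sub>F t in at 0. c t \<in> SL2"
    using SL2_curve[OF ab(1)] by blast
  obtain d where d: "d 0 = mat 1" "(d has_derivative (\<lambda>s. s *\<^sub>R b)) (at 0)" "\<forall>\<^sub>F t in at 0. d t \<in> SL2"
    using SL2_curve[OF ab(2)] by blast
  define g where "g = (\<lambda>t. pmul p (c t, d t))"
  have g0: "g 0 = p" by (simp add: g_def c d)
  have "(g has_derivative (\<lambda>s. pmul p (s *\<^sub>R a, s *\<^sub>R b))) (at 0)"
    unfolding g_def by (rule bounded_linear.has_derivative[OF pmul.bounded_linear_right])
      (rule has_derivative_Pair[OF c(2) d(2)])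
  then have "((\<lambda>t. h (g t)) has_derivative (\<lambda>s. deriv_at h p (pmul p (s *\<^sub>R a, s *\<^sub>R b)))) (at 0)"
    by (rule has_derivative_compose) (simp add: g0 has_derivative_deriv_at[OF h])
  moreover have "((\<lambda>t. h (g t)) has_derivative (\<lambda>s. 0)) (at 0)"
  proof (rule has_derivative_transform_eventually[OF has_derivative_const])
    show "\<forall>\<^sub>F t in at 0. k = h (g t)"
      using c(3) d(3)
    proof eventually_elim
      case (elim t)
      then have "g t \<in> SLSL" unfolding g_def by (intro SLSL_pmul p) (simp add: SLSL_def)
      then show ?case by (simp add: const)
    qed
    show "k = h (g 0)" by (simp add: g0 const p)
  qed simp
  ultimately have "(\<lambda>s. deriv_at h p (pmul p (s *\<^sub>R a, s *\<^sub>R b))) = (\<lambda>s. 0)"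
    by (rule has_derivative_unique)
  from fun_cong[OF this, of 1] show ?thesis by (simp add: ab)
qed

lemma deriv_padj: "f differentiable (at x) \<Longrightarrow> deriv_at (\<lambda>x. padj (f x)) x v = padj (deriv_at f x v)"
  by (rule deriv_at_linear[OF bounded_linear_padj])

lemma differentiable_padj: "f differentiable (at x) \<Longrightarrow> (\<lambda>x. padj (f x)) differentiable (at x)"
  by (rule differentiable_linear[OF bounded_linear_padj])

lemma deriv_left_trivialised:
  fixes f Y :: "'a::real_normed_vector \<Rightarrow> mat2 \<times> mat2"
  assumes "f differentiable (at u)" "Y differentiable (at u)"
    and p: "f u \<in> SLSL" and v: "deriv_at f u x \<in> tangent_space (f u)"
  shows "deriv_at (\<lambda>w. pmul (padj (f w)) (Y w)) u x
     = pmul (padj (f u)) (deriv_at Y u x) - pmul (pmul (padj (f u)) (deriv_at f u x)) (pmul (padj (f u)) (Y u))"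
proof -
  define t where "t = pmul (padj (f u)) (deriv_at f u x)"
  have t: "t \<in> sl2_pairs" using v p tangent_space_iff unfolding t_def by blast
  have "deriv_at f u x = pmul (f u) t" by (simp add: t_def pmul_padj_cancel[OF p])
  then have "padj (deriv_at f u x) = - pmul t (padj (f u))"
    by (simp only: padj_pmul padj_sl2_pairs[OF t] pmul.minus_left)
  then show ?thesis
    using assms(1,2)
    by (simp add: deriv_at_bilinear[OF bounded_bilinear_pmul] differentiable_padj deriv_padj
        pmul.minus_left pmul_assoc flip: t_def)
qed

text \<open>After trivialisation the connection is the ordinary derivative plus \<open>conn\<close>, for fields along any map \<open>f\<close>. The identity map gives the
  connection on \<open>SLSL\<close>; an immersion gives the connection along a surface.\<close>

lemma pmul_LC:
  assumes "f differentiable (at u)" "Y differentiable (at u)"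
    and p: "f u \<in> SLSL" and v: "deriv_at f u x \<in> tangent_space (f u)"
  shows "deriv_at Y u x + LC (f u) (deriv_at f u x) (Y u)
    = pmul (f u) (deriv_at (\<lambda>w. pmul (padj (f w)) (Y w)) u x
         + conn (pmul (padj (f u)) (deriv_at f u x)) (pmul (padj (f u)) (Y u)))"
  by (simp add: deriv_left_trivialised[OF assms] LC_def pmul.add_right pmul.diff_right pmul_padj_cancel[OF p])

lemma vector_fieldD:
  assumes "vector_field X"
  shows "X differentiable (at p)" "p \<in> SLSL \<Longrightarrow> X p \<in> tangent_space p"
  using assms smooth_on_differentiable[of UNIV X p] by (auto simp: vector_field_def)

lemma covariant_derivative_LC:
  assumes X: "vector_field X" and Y: "vector_field Y" and p: "p \<in> SLSL"
  shows "covariant_derivative LC X Y p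
    = pmul p (deriv_at (\<lambda>q. pmul (padj q) (Y q)) p (X p)
         + conn (pmul (padj p) (X p)) (pmul (padj p) (Y p)))"
  using pmul_LC[of "\<lambda>q. q" p Y "X p"] vector_fieldD[OF X] vector_fieldD[OF Y] p
  by (simp add: covariant_derivative_def)

lemma tangent_space_pmul: "p \<in> SLSL \<Longrightarrow> pmul p x \<in> tangent_space p \<longleftrightarrow> x \<in> sl2_pairs"
  by (simp add: tangent_space_iff padj_pmul_cancel)

lemma deriv_left_trivialised_sl2_pairs:
  assumes X: "vector_field X" and Y: "vector_field Y" and p: "p \<in> SLSL"
  shows "deriv_at (\<lambda>q. pmul (padj q) (Y q)) p (X p) \<in> sl2_pairs"
proof -
  obtain L :: "mat2 \<times> mat2 \<Rightarrow> real \<times> real" where L: "bounded_linear L" and L0: "\<And>x. L x = 0 \<longleftrightarrow> x \<in> sl2_pairs"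
    using sl2_pairs_kernel by blast
  define y where "y = (\<lambda>q. pmul (padj q) (Y q))"
  have y: "y differentiable (at p)"
    unfolding y_def by (intro differentiable_bilinear[OF bounded_bilinear_pmul] differentiable_padj
        vector_fieldD[OF Y] differentiable_ident)
  have "deriv_at (\<lambda>q. L (y q)) p (X p) = 0"
  proof (rule tangential_derivative_zero[OF p _ _, where k=0])
    show "X p \<in> tangent_space p" by (rule vector_fieldD(2)[OF X p])
    show "L (y q) = 0" if "q \<in> SLSL" for q
      using vector_fieldD(2)[OF Y that] that tangent_space_iff by (simp only: L0 y_def)
  qed (rule differentiable_linear[OF L y])
  then show ?thesis by (simp only: deriv_at_linear[OF L y] L0 flip: y_def)
qed

text \<open>Off \<open>SLSL\<close> the inverse in \<open>metric_g\<close> is the adjugate divided by the determinant, on the open set where the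
  determinants do not vanish.\<close>

lemma differentiable_metric:
  assumes p: "p \<in> SLSL" and Y: "Y differentiable (at p)" and Z: "Z differentiable (at p)"
  shows "(\<lambda>q. metric_g q (Y q) (Z q)) differentiable (at p)"
proof -
  \<comment> \<open>the determinant is the pairing of a matrix with its adjugate, which reduces its differentiability to that of bilinear maps\<close>
  define U where "U = {q::mat2 \<times> mat2. det (fst q) \<noteq> 0 \<and> det (snd q) \<noteq> 0}"
  have det_eq: "det A = sl2_form A (adj2 A)" for A :: mat2
    by (simp add: sl2_form_def mult_adj2) (simp add: trace_def mat_def sum_2)
  define i where "i = (\<lambda>A::mat2. (1 / det A) *\<^sub>R adj2 A)"
  define D where "D = (\<lambda>(Y::mat2 \<times> mat2 \<Rightarrow> mat2 \<times> mat2) q. pmul (i (fst q), i (snd q)) (Y q))"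
  have ddet: "(\<lambda>q. det (L q)) differentiable (at p)" and dadj: "(\<lambda>q. adj2 (L q)) differentiable (at p)"
    if "L differentiable (at p)" for L :: "mat2 \<times> mat2 \<Rightarrow> mat2"
    unfolding det_eq by (intro differentiable_bilinear[OF bounded_bilinear_sl2_form] 
        differentiable_linear[OF bounded_linear_adj2] that)+
  have fs: "fst differentiable (at p)" "snd differentiable (at p)"
    by (intro bounded_linear_imp_differentiable bounded_linear_fst bounded_linear_snd)+
  have di: "(\<lambda>q. i (L q)) differentiable (at p)" if "L differentiable (at p)" "det (L p) \<noteq> 0"
    for L :: "mat2 \<times> mat2 \<Rightarrow> mat2"
    unfolding i_def by (intro differentiable_scaleR differentiable_divide differentiable_const ddet dadj that)
  have pU: "p \<in> U" using p by (auto simp: U_def SLSL_def SL2_def)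
  have dD: "D Y differentiable (at p)" if "Y differentiable (at p)" for Y
    unfolding D_def using pU that
    by (intro differentiable_bilinear[OF bounded_bilinear_pmul] differentiable_Pair di fs) (auto simp: U_def)
  have "(\<lambda>q. gform (D Y q) (D Z q)) differentiable (at p)"
    by (intro differentiable_bilinear[OF bounded_bilinear_gform] dD Y Z)
  moreover have "open U"
    unfolding U_def det_2 by (intro open_Collect_conj open_Collect_neq continuous_intros)
  moreover have "metric_g q (Y q) (Z q) = gform (D Y q) (D Z q)" if "q \<in> U" for q
    using that by (simp add: U_def metric_g_def Let_def gform_def D_def i_def pmul_def matrix_inv_adj2)
  ultimately show ?thesis using pU unfolding differentiable_def
    by (metis (no_types, lifting) has_derivative_transform_within_open)
qed

text \<open>For the metric condition, \<open>metric_g\<close> and \<open>gform\<close> of the trivialised fields agree on \<open>SLSL\<close>, hence have the same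
  tangential derivative, and the latter is differentiated by the product rule.\<close>

lemma LC_levi_civita: "is_levi_civita LC"
  unfolding is_levi_civita_def
proof (intro conjI allI impI ballI)
  fix p show "bilinear (LC p)"
    unfolding bilinear_conv_bounded_bilinear
    by (rule bounded_bilinearI)
       (simp_all add: LC_def pmul.add_left pmul.add_right pmul.diff_right pmul.scaleR_left pmul.scaleR_right
         conn.add_left conn.add_right conn.scaleR_left conn.scaleR_right algebra_simps)
next
  fix X Y p assume XY: "vector_field X \<and> vector_field Y" and p: "p \<in> SLSL"
  then show "covariant_derivative LC X Y p \<in> tangent_space p"
    using deriv_left_trivialised_sl2_pairs[of X Y p] 
    by (simp only: covariant_derivative_LC tangent_space_pmul subspace_add[OF subspace_sl2_pairs] conn_sl2_pairs)
  have "conn x y - pmul x y - (conn y x - pmul y x) = 0" for x y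
    using conn_torsion[of x y] by (simp add: pbr_eq algebra_simps)
  then have "LC p (X p) (Y p) - LC p (Y p) (X p) = 0"
    by (simp only: LC_def pmul.diff_right[symmetric] pmul.zero_right)
  then show "covariant_derivative LC X Y p - covariant_derivative LC Y X p = lie_bracket X Y p"
    by (simp add: covariant_derivative_def lie_bracket_def)
next
  fix X Y Z p assume XYZ: "vector_field X \<and> vector_field Y \<and> vector_field Z" and p: "p \<in> SLSL"
  then have X: "vector_field X" and Y: "vector_field Y" and Z: "vector_field Z" by auto
  define F where "F = (\<lambda>q. metric_g q (Y q) (Z q))"
  define y where "y = (\<lambda>q. pmul (padj q) (Y q))"
  define z where "z = (\<lambda>q. pmul (padj q) (Z q))"
  define x where "x = pmul (padj p) (X p)"
  have dy: "y differentiable (at p)" and dz: "z differentiable (at p)"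
    unfolding y_def z_def by (intro differentiable_bilinear[OF bounded_bilinear_pmul] differentiable_padj
        vector_fieldD[OF Y] vector_fieldD[OF Z] differentiable_ident)+
  have dF: "F differentiable (at p)"
    unfolding F_def by (intro differentiable_metric p vector_fieldD[OF Y] vector_fieldD[OF Z])
  have dG: "(\<lambda>q. gform (y q) (z q)) differentiable (at p)"
    by (intro differentiable_bilinear[OF bounded_bilinear_gform] dy dz)
  have "deriv_at (\<lambda>q. F q - gform (y q) (z q)) p (X p) = 0"
    by (rule tangential_derivative_zero[OF p vector_fieldD(2)[OF X p] differentiable_diff[OF dF dG], of 0])
       (simp add: F_def y_def z_def metric_g_gform)
  then have "deriv_at F p (X p) = deriv_at (\<lambda>q. gform (y q) (z q)) p (X p)"
    using deriv_at_eq[OF has_derivative_diff[OF has_derivative_deriv_at[OF dF] has_derivative_deriv_at[OF dG]], of "X p"]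
    by simp
  also have "\<dots> = gform (y p) (deriv_at z p (X p)) + gform (deriv_at y p (X p)) (z p)"
    by (rule deriv_at_bilinear[OF bounded_bilinear_gform dy dz])
  also have "\<dots> = gform (deriv_at y p (X p) + conn x (y p)) (z p) + gform (y p) (deriv_at z p (X p) + conn x (z p))"
    using conn_metric[of x "y p" "z p"] by (simp add: gform.add_left gform.add_right)
  also have "\<dots> = metric_g p (covariant_derivative LC X Y p) (Z p) + metric_g p (Y p) (covariant_derivative LC X Z p)"
    by (simp add: covariant_derivative_LC X Y Z p metric_g_gform padj_pmul_cancel flip: x_def y_def z_def)
       (simp add: y_def z_def)
  finally show "deriv_at (\<lambda>q. metric_g q (Y q) (Z q)) p (X p) = metric_g p (covariant_derivative LC X Y p) (Z p) +
          metric_g p (Y p) (covariant_derivative LC X Z p)"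
    by (simp add: F_def)
qed

lemma vector_field_left_invariant: "x \<in> sl2_pairs \<Longrightarrow> vector_field (\<lambda>q. pmul q x)"
  by (simp add: vector_field_def tangent_space_pmul smooth_on_bounded_linear[OF pmul.bounded_linear_left])

lemma is_levi_civitaD:
  assumes "is_levi_civita \<Gamma>" "vector_field X" "vector_field Y" "p \<in> SLSL"
  shows "covariant_derivative \<Gamma> X Y p \<in> tangent_space p"
    and "covariant_derivative \<Gamma> X Y p - covariant_derivative \<Gamma> Y X p = lie_bracket X Y p"
    and "vector_field Z \<Longrightarrow> deriv_at (\<lambda>q. metric_g q (Y q) (Z q)) p (X p)
      = metric_g p (covariant_derivative \<Gamma> X Y p) (Z p) + metric_g p (Y p) (covariant_derivative \<Gamma> X Z p)"
  using assms unfolding is_levi_civita_def by simp_all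

text \<open>The difference \<open>T\<close> of the two connections is a tensor, so left-invariant fields suffice to test it.
  The trilinear form \<open>gform (T x y) z\<close> is symmetric in \<open>x, y\<close> and skew in \<open>y, z\<close>, hence zero.\<close>

lemma levi_civita_unique:
  assumes G: "is_levi_civita \<Gamma>" and p: "p \<in> SLSL"
    and v: "v \<in> tangent_space p" and w: "w \<in> tangent_space p"
  shows "\<Gamma> p v w = LC p v w"
proof -
  define cov where "cov \<Gamma> x y = covariant_derivative \<Gamma> (\<lambda>q. pmul q x) (\<lambda>q. pmul q y) p" for \<Gamma> x y
  define T where "T x y = pmul (padj p) (cov \<Gamma> x y - cov LC x y)" for x y
  note vf = vector_field_left_invariant
  have tan: "pmul (padj p) (cov \<Gamma>' x y) \<in> sl2_pairs" if "is_levi_civita \<Gamma>'" "x \<in> sl2_pairs" "y \<in> sl2_pairs" for \<Gamma>' x y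
    using is_levi_civitaD(1)[OF that(1) vf[OF that(2)] vf[OF that(3)] p] tangent_space_iff[OF p]
    by (simp add: cov_def)
  have Tt: "T x y \<in> sl2_pairs" if "x \<in> sl2_pairs" "y \<in> sl2_pairs" for x y
    unfolding T_def pmul.diff_right by (intro subspace_diff[OF subspace_sl2_pairs] tan G LC_levi_civita that)
  have tor: "cov \<Gamma>' x y - cov \<Gamma>' y x = lie_bracket (\<lambda>q. pmul q x) (\<lambda>q. pmul q y) p"
    if "is_levi_civita \<Gamma>'" "x \<in> sl2_pairs" "y \<in> sl2_pairs" for \<Gamma>' x y
    unfolding cov_def by (rule is_levi_civitaD(2)[OF that(1) vf[OF that(2)] vf[OF that(3)] p])
  have sym: "T x y = T y x" if "x \<in> sl2_pairs" "y \<in> sl2_pairs" for x y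
  proof -
    have "cov \<Gamma> x y - cov LC x y = cov \<Gamma> y x - cov LC y x"
      using tor[OF G that] tor[OF LC_levi_civita that] by (simp add: algebra_simps)
    then show ?thesis by (simp add: T_def)
  qed
  have met: "deriv_at (\<lambda>q. metric_g q (pmul q y) (pmul q z)) p (pmul p x)
       = gform (pmul (padj p) (cov \<Gamma>' x y)) z + gform y (pmul (padj p) (cov \<Gamma>' x z))"
    if "is_levi_civita \<Gamma>'" "x \<in> sl2_pairs" "y \<in> sl2_pairs" "z \<in> sl2_pairs" for \<Gamma>' x y z
  proof -
    have "deriv_at (\<lambda>q. metric_g q (pmul q y) (pmul q z)) p (pmul p x)
       = metric_g p (cov \<Gamma>' x y) (pmul p z) + metric_g p (pmul p y) (cov \<Gamma>' x z)"
      unfolding cov_def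
      by (rule is_levi_civitaD(3)[OF that(1) vf[OF that(2)] vf[OF that(3)] p vf[OF that(4)]])
    then show ?thesis by (simp add: metric_g_gform p padj_pmul_cancel)
  qed
  have skew: "gform (T x y) z = - gform (T x z) y" if "x \<in> sl2_pairs" "y \<in> sl2_pairs" "z \<in> sl2_pairs" for x y z
    using met[OF G that] met[OF LC_levi_civita that]
    by (simp add: T_def pmul.diff_right gform.diff_left gform_commute[of y])
  have z0: "gform (T x y) z = 0" if "x \<in> sl2_pairs" "y \<in> sl2_pairs" "z \<in> sl2_pairs" for x y z
  proof -
    have "gform (T x y) z = - gform (T x z) y" by (rule skew[OF that])
    also have "gform (T x z) y = gform (T z x) y" by (simp only: sym[OF that(1,3)])
    also have "\<dots> = - gform (T z y) x" by (rule skew[OF that(3,1,2)])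
    also have "gform (T z y) x = gform (T y z) x" by (simp only: sym[OF that(2,3)])
    also have "\<dots> = - gform (T y x) z" by (rule skew[OF that(2,3,1)])
    also have "gform (T y x) z = gform (T x y) z" by (simp only: sym[OF that(1,2)])
    finally show ?thesis by simp
  qed
  have T0: "T x y = 0" if "x \<in> sl2_pairs" "y \<in> sl2_pairs" for x y
    by (rule gform_nondegenerate[OF Tt[OF that] _]) (simp add: that z0[OF that])
  define x where "x = pmul (padj p) v"
  define y where "y = pmul (padj p) w"
  have xy: "x \<in> sl2_pairs" "y \<in> sl2_pairs" using v w tangent_space_iff[OF p] by (auto simp: x_def y_def)
  have "pmul p (T x y) = 0" by (simp add: T0[OF xy] pmul.zero_right)
  then have "cov \<Gamma> x y = cov LC x y" by (simp add: T_def pmul_padj_cancel[OF p])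
  then show ?thesis
    by (simp add: cov_def covariant_derivative_def x_def y_def pmul_padj_cancel[OF p])
qed

lemma levi_civita_eq_LC:
  assumes "p \<in> SLSL" "v \<in> tangent_space p" "w \<in> tangent_space p"
  shows "levi_civita p v w = LC p v w"
proof (rule levi_civita_unique)
  show "is_levi_civita levi_civita"
    unfolding levi_civita_def by (rule someI[of is_levi_civita, OF LC_levi_civita])
qed (rule assms)+

section \<open>Flat totally geodesic surfaces in a chart\<close>

text \<open>The derivative of the determinant at \<open>A\<close> in the direction \<open>V\<close> is the trace of \<open>adj2 A ** V\<close>, and the
  determinant is constant along \<open>f\<close>.\<close>

lemma tangent_SLSL_map:
  fixes f :: "'a::real_normed_vector \<Rightarrow> mat2 \<times> mat2"
  assumes S: "open S" "u \<in> S" and f: "f differentiable (at u)" and im: "\<And>w. w \<in> S \<Longrightarrow> f w \<in> SLSL"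
  shows "deriv_at f u v \<in> tangent_space (f u)"
proof -
  have trace_zero: "trace (adj2 (L (f u)) ** L (deriv_at f u v)) = 0"
    if L: "bounded_linear L" and det: "\<And>w. w \<in> S \<Longrightarrow> det (L (f w)) = 1" for L :: "mat2 \<times> mat2 \<Rightarrow> mat2"
  proof -
    have det_eq: "sl2_form A (adj2 A) = det A" and det': "sl2_form A (adj2 V) + sl2_form V (adj2 A) = trace (adj2 A ** V)" for A V :: mat2
      by (simp_all add: sl2_form_def adj2_def mat2_simps algebra_simps)
    have d: "(\<lambda>w. L (f w)) differentiable (at u)" "(\<lambda>w. adj2 (L (f w))) differentiable (at u)"
      by (intro differentiable_linear[OF L] differentiable_linear[OF bounded_linear_adj2] f)+
    have "deriv_at (\<lambda>w. sl2_form (L (f w)) (adj2 (L (f w)))) u v = deriv_at (\<lambda>w. 1) u v"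
      by (rule fun_cong[OF frechet_derivative_transform_within_open[OF
            differentiable_bilinear[OF bounded_bilinear_sl2_form d] S]])
         (simp add: det_eq det)
    then show ?thesis
      by (simp add: deriv_at_bilinear[OF bounded_bilinear_sl2_form d] deriv_at_linear[OF bounded_linear_adj2 d(1)]
          deriv_at_linear[OF L f] det')
  qed
  have "f w \<in> SL2 \<times> SL2" if "w \<in> S" for w using im[OF that] by (simp add: SLSL_def)
  then have "trace (adj2 (fst (f u)) ** fst (deriv_at f u v)) = 0" "trace (adj2 (snd (f u)) ** snd (deriv_at f u v)) = 0"
    by (auto intro!: trace_zero bounded_linear_fst bounded_linear_snd simp: SL2_def mem_Times_iff)
  then show ?thesis using im[OF S(2)]
    by (simp add: tangent_space_iff pmul_def padj_def sl2_def)
qed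

text \<open>The immersion read in one chart, with the hypotheses of the theorem at the points of the chart image.\<close>

locale flat_chart =
  fixes f :: "real ^ 2 \<Rightarrow> mat2 \<times> mat2" and S :: "(real ^ 2) set"
  assumes open_S: "open S" and smooth_f: "smooth_on S f" and f_SLSL: "u \<in> S \<Longrightarrow> f u \<in> SLSL"
    and complex: "u \<in> S \<Longrightarrow> complex_J (f u) ` range (deriv_at f u) \<subseteq> range (deriv_at f u)"
    and positive: "u \<in> S \<Longrightarrow> x \<noteq> 0 \<Longrightarrow> metric_g (f u) (deriv_at f u x) (deriv_at f u x) > 0"
    and geodesic: "u \<in> S \<Longrightarrow> second_fundamental_form f u x y = 0"
    and flat: "u \<in> S \<Longrightarrow> gauss_curvature (induced_metric f) u = 0"
begin

text \<open>\<open>X v\<close> is the trivialised partial derivative of \<open>f\<close> along the constant field \<open>v\<close>, and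
  \<open>covX v w\<close> is the trivialised covariant derivative of \<open>\<partial>\<^sub>w f\<close> along \<open>v\<close>.\<close>

definition X :: "real ^ 2 \<Rightarrow> real ^ 2 \<Rightarrow> mat2 \<times> mat2" where
  "X v u = pmul (padj (f u)) (deriv_at f u v)"

definition covX :: "real ^ 2 \<Rightarrow> real ^ 2 \<Rightarrow> real ^ 2 \<Rightarrow> mat2 \<times> mat2" where
  "covX v w u = deriv_at (X w) u v + conn (X v u) (X w u)"

lemma diff_f: "u \<in> S \<Longrightarrow> f differentiable (at u)"
  by (rule smooth_on_differentiable[OF smooth_f])

lemma smooth_X: "smooth_on S (X v)"
  unfolding X_def
  by (intro smooth_on_bilinear[OF open_S bounded_bilinear_pmul] smooth_on_linear[OF open_S bounded_linear_padj]
      smooth_on_deriv smooth_f)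

lemma diff_X: "u \<in> S \<Longrightarrow> X v differentiable (at u)"
  by (rule smooth_on_differentiable[OF smooth_X])

lemma diff_DX: "u \<in> S \<Longrightarrow> (\<lambda>u. deriv_at (X w) u v) differentiable (at u)"
  by (rule smooth_on_differentiable[OF smooth_on_deriv[OF smooth_X]])

lemma tangent: "u \<in> S \<Longrightarrow> deriv_at f u v \<in> tangent_space (f u)"
  by (rule tangent_SLSL_map[OF open_S _ diff_f f_SLSL])

lemma X_sl2_pairs: "u \<in> S \<Longrightarrow> X v u \<in> sl2_pairs"
  using tangent tangent_space_iff f_SLSL unfolding X_def by blast

lemma pmul_X: "u \<in> S \<Longrightarrow> pmul (f u) (X v u) = deriv_at f u v"
  by (simp add: X_def pmul_padj_cancel f_SLSL)

lemma linear_X: "u \<in> S \<Longrightarrow> linear (\<lambda>v. X v u)"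
  unfolding X_def
  using linear_compose[OF linear_frechet_derivative[OF diff_f] bounded_linear.linear[OF pmul.bounded_linear_right]]
  by (simp add: o_def)

lemma X_add: "u \<in> S \<Longrightarrow> X (v + w) u = X v u + X w u"
  and X_scaleR: "u \<in> S \<Longrightarrow> X (c *\<^sub>R v) u = c *\<^sub>R X v u"
  using linear_add[OF linear_X] linear_cmul[OF linear_X] by simp_all

lemma metric_X: "u \<in> S \<Longrightarrow> metric_g (f u) (deriv_at f u v) (deriv_at f u w) = gform (X v u) (X w u)"
  by (simp add: metric_g_gform f_SLSL X_def)

lemma positive_X: "u \<in> S \<Longrightarrow> v \<noteq> 0 \<Longrightarrow> gform (X v u) (X v u) > 0"
  using positive metric_X by metis

lemma J_invariant:
  assumes "u \<in> S" shows "\<exists>w. X w u = Jform (X v u)"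
proof -
  obtain w where "complex_J (f u) (deriv_at f u v) = deriv_at f u w"
    using complex[OF assms] by blast
  then have "pmul (padj (f u)) (pmul (f u) (Jform (X v u))) = X w u"
    by (simp add: complex_J_Jform f_SLSL assms X_def)
  then show ?thesis by (metis padj_pmul_cancel f_SLSL assms)
qed

lemma vec2_eq: "v = v$1 *\<^sub>R axis 1 1 + v$2 *\<^sub>R axis 2 (1::real)" for v :: "real^2"
  by (simp add: vec_eq_iff forall_2 axis_def)

lemma X_expand: "u \<in> S \<Longrightarrow> X v u = v$1 *\<^sub>R X (axis 1 1) u + v$2 *\<^sub>R X (axis 2 1) u"
  by (subst vec2_eq[of v]) (simp add: X_add X_scaleR)

text \<open>The tangent plane contains \<open>J X\<^sub>2\<close>, which is orthogonal to \<open>X\<^sub>2\<close> and of the same length, so \<open>X\<^sub>2\<close> and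
  \<open>J X\<^sub>2\<close> form a basis. The pair \<open>X\<^sub>1, X\<^sub>2\<close> is another one, whence \<open>q \<noteq> 0\<close>.\<close>

lemma complex_frame:
  assumes u: "u \<in> S" 
  shows "\<exists>p q. X v u = p *\<^sub>R X (axis 2 1) u + q *\<^sub>R Jform (X (axis 2 1) u)"
    and "\<exists>p q. q \<noteq> 0 \<and> X (axis 1 1) u = p *\<^sub>R X (axis 2 1) u + q *\<^sub>R Jform (X (axis 2 1) u)"
proof -
  let ?X1 = "X (axis 1 1) u" and ?X2 = "X (axis 2 1) u"
  obtain w where w: "X w u = Jform ?X2" using J_invariant[OF u] by blast
  have "gform ?X2 ?X2 > 0" by (rule positive_X[OF u]) (simp add: axis_eq_0_iff)
  then have w1: "w $ 1 \<noteq> 0"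
    using w gform_Jform[of ?X2] X_expand[OF u, of w]
    by (metis add.left_neutral gform.scaleR_left gform.scaleR_right gform.zero_left less_irrefl mult_eq_0_iff real_scaleR_def scaleR_zero_left)
  have "Jform ?X2 = w$1 *\<^sub>R ?X1 + w$2 *\<^sub>R ?X2" using w X_expand[OF u, of w] by simp
  then have "(1 / w$1) *\<^sub>R Jform ?X2 = ?X1 + (w$2 / w$1) *\<^sub>R ?X2"
    using w1 by (simp add: scaleR_add_right)
  then have X1: "?X1 = (- w$2 / w$1) *\<^sub>R ?X2 + (1 / w$1) *\<^sub>R Jform ?X2" by simp
  then show "\<exists>p q. q \<noteq> 0 \<and> ?X1 = p *\<^sub>R ?X2 + q *\<^sub>R Jform ?X2" 
    using w1 by (intro exI[of _ "- w$2 / w$1"] exI[of _ "1 / w$1"]) simp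
  have "X v u = (v$1 * (- w$2 / w$1) + v$2) *\<^sub>R ?X2 + (v$1 * (1 / w$1)) *\<^sub>R Jform ?X2"
    unfolding X_expand[OF u, of v] X1 by (simp add: algebra_simps)
  then show "\<exists>p q. X v u = p *\<^sub>R ?X2 + q *\<^sub>R Jform ?X2" by blast
qed

text \<open>This makes the definite description in \<open>normal_component\<close> meaningful. Although \<open>g\<close> is indefinite, its restriction to the tangent
  plane is definite, and \<open>X\<^sub>2, J X\<^sub>2\<close> is an orthogonal basis to project with.\<close>

lemma orthogonal_decomposition:
  assumes u: "u \<in> S" and t: "t \<in> tangent_space (f u)"
  shows "\<exists>!n. n \<in> tangent_space (f u) \<and> (\<forall>w\<in>range (deriv_at f u). metric_g (f u) n w = 0) \<and> t - n \<in> range (deriv_at f u)"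
proof (rule ex_ex1I)
  let ?E = "X (axis 2 1) u"
  define s where "s = pmul (padj (f u)) t"
  have s: "s \<in> sl2_pairs" using t u by (simp add: s_def tangent_space_iff f_SLSL)
  obtain w where w: "X w u = Jform ?E" using J_invariant[OF u] by blast
  define c where "c = gform ?E ?E"
  have c: "c > 0" unfolding c_def by (rule positive_X[OF u]) (simp add: axis_eq_0_iff)
  define a where "a = (gform s ?E / c) *\<^sub>R axis 2 1 + (gform s (Jform ?E) / c) *\<^sub>R w"
  have Xa: "X a u = (gform s ?E / c) *\<^sub>R ?E + (gform s (Jform ?E) / c) *\<^sub>R Jform ?E"
    by (simp add: a_def X_add X_scaleR u w)
  have o: "gform (s - X a u) ?E = 0" "gform (s - X a u) (Jform ?E) = 0"
    using c gform_Jform[of ?E] gform_commute[of "Jform ?E" ?E]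
    by (simp_all add: Xa gform.diff_left gform.add_left gform.scaleR_left flip: c_def)
  have "metric_g (f u) (t - deriv_at f u a) (deriv_at f u v) = 0" for v
  proof -
    obtain p q where "X v u = p *\<^sub>R ?E + q *\<^sub>R Jform ?E" using complex_frame(1)[OF u] by blast
    then have "gform (s - X a u) (X v u) = 0" by (simp add: gform.add_right gform.scaleR_right o)
    then show ?thesis by (simp add: metric_g_gform f_SLSL u X_def s_def pmul.diff_right)
  qed
  moreover have "t - deriv_at f u a \<in> tangent_space (f u)"
    using subspace_diff[OF subspace_sl2_pairs s X_sl2_pairs[OF u, of a]]
    by (simp add: tangent_space_iff f_SLSL u s_def X_def pmul.diff_right)
  ultimately show "\<exists>n. n \<in> tangent_space (f u) \<and> (\<forall>w\<in>range (deriv_at f u). metric_g (f u) n w = 0) \<and> t - n \<in> range (deriv_at f u)"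
    by (intro exI[of _ "t - deriv_at f u a"]) auto
next
  fix n n'
  assume n: "n \<in> tangent_space (f u) \<and> (\<forall>w\<in>range (deriv_at f u). metric_g (f u) n w = 0) \<and> t - n \<in> range (deriv_at f u)"
    and n': "n' \<in> tangent_space (f u) \<and> (\<forall>w\<in>range (deriv_at f u). metric_g (f u) n' w = 0) \<and> t - n' \<in> range (deriv_at f u)"
  then obtain x x' where x: "t - n = deriv_at f u x" "t - n' = deriv_at f u x'" by blast
  have "n' - n = deriv_at f u x - deriv_at f u x'" by (simp flip: x)
  also have "\<dots> = deriv_at f u (x - x')"
    by (simp add: linear_diff linear_frechet_derivative diff_f u)
  finally have d: "n' - n = deriv_at f u (x - x')" .
  have "metric_g (f u) (n' - n) (deriv_at f u (x - x')) = 0"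
    using n n' by (simp add: metric_g_gform f_SLSL u pmul.diff_right gform.diff_left)
  then have "x - x' = 0" using positive[OF u, of "x - x'"] unfolding d by force
  then show "n = n'" using d by (simp add: linear_0 linear_frechet_derivative diff_f u)
qed

lemma deriv_X: "u \<in> S \<Longrightarrow> deriv_at (X w) u v
    = pmul (padj (f u)) (deriv_at (\<lambda>u. deriv_at f u w) u v) - pmul (X v u) (X w u)"
  unfolding X_def
  by (rule deriv_left_trivialised[OF diff_f smooth_on_differentiable[OF smooth_on_deriv[OF smooth_f]] f_SLSL tangent])

text \<open>The Maurer-Cartan equation: the second derivatives of \<open>f\<close> are symmetric, and only the products that stem from
  differentiating the trivialisation survive.\<close>

lemma deriv_X_antisym: "u \<in> S \<Longrightarrow> deriv_at (X w) u v - deriv_at (X v) u w = - pbr (X v u) (X w u)"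
  using symmetric_second_derivative[OF open_S smooth_f, of u v w]
  by (simp add: deriv_X pbr_eq)

lemma covX_sym: "u \<in> S \<Longrightarrow> covX v w u = covX w v u"
  using deriv_X_antisym[of u w v] conn_torsion[of "X v u" "X w u"]
  by (simp add: covX_def algebra_simps)

lemma covX_sl2_pairs: "u \<in> S \<Longrightarrow> covX v w u \<in> sl2_pairs"
proof -
  assume u: "u \<in> S"
  obtain L :: "mat2 \<times> mat2 \<Rightarrow> real \<times> real" where L: "bounded_linear L" and L0: "\<And>x. L x = 0 \<longleftrightarrow> x \<in> sl2_pairs"
    using sl2_pairs_kernel by blast
  have "deriv_at (\<lambda>u. L (X w u)) u = deriv_at (\<lambda>u. 0) u"
    by (rule frechet_derivative_transform_within_open[OF differentiable_linear[OF L diff_X[OF u]] open_S u])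
       (simp only: L0 X_sl2_pairs)
  then have "L (deriv_at (X w) u v) = 0"
    using deriv_at_linear[OF L diff_X[OF u], of w v] by simp
  then show ?thesis unfolding covX_def L0
    by (intro subspace_add[OF subspace_sl2_pairs] conn_sl2_pairs)
qed

text \<open>The second fundamental form is the normal part of the covariant derivative; as it vanishes, the whole derivative is tangent to
  the surface.\<close>

lemma covX_tangent: assumes u: "u \<in> S" shows "\<exists>x. covX v w u = X x u"
proof -
  let ?t = "cov_deriv_along f v (\<lambda>u. deriv_at f u w) u"
  have t: "?t = pmul (f u) (covX v w u)"
    using pmul_LC[OF diff_f[OF u] smooth_on_differentiable[OF smooth_on_deriv[OF smooth_f] u] f_SLSL[OF u] tangent[OF u], of w v]
    by (simp add: cov_deriv_along_def levi_civita_eq_LC f_SLSL tangent u covX_def X_def[symmetric])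
  have "?t \<in> tangent_space (f u)"
    unfolding t by (simp only: tangent_space_pmul f_SLSL u covX_sl2_pairs)
  from theI'[OF orthogonal_decomposition[OF u this]]
  have "?t - normal_component (f u) (range (deriv_at f u)) ?t \<in> range (deriv_at f u)"
    unfolding normal_component_def by blast
  moreover have "normal_component (f u) (range (deriv_at f u)) ?t = 0"
    using geodesic[OF u, of v w] by (simp add: second_fundamental_form_def)
  ultimately obtain x where "pmul (f u) (covX v w u) = pmul (f u) (X x u)"
    by (auto simp: t pmul_X u)
  then show ?thesis by (metis padj_pmul_cancel f_SLSL u)
qed

abbreviation E :: "2 \<Rightarrow> real ^ 2" where "E i \<equiv> axis i 1"

text \<open>\<open>G\<close> is the induced metric, \<open>H i j l\<close> the product of \<open>\<nabla>\<^sub>i \<partial>\<^sub>j f\<close> with \<open>\<partial>\<^sub>l f\<close>, and \<open>gam k i j\<close> the coefficient of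
  \<open>\<partial>\<^sub>k f\<close> in \<open>\<nabla>\<^sub>i \<partial>\<^sub>j f\<close>, solved for by Cramer's rule. The explicit quotient shows that it is differentiable.\<close>

definition G :: "2 \<Rightarrow> 2 \<Rightarrow> real ^ 2 \<Rightarrow> real" where
  "G i j u = gform (X (E i) u) (X (E j) u)"

definition H :: "2 \<Rightarrow> 2 \<Rightarrow> 2 \<Rightarrow> real ^ 2 \<Rightarrow> real" where
  "H i j l u = gform (covX (E i) (E j) u) (X (E l) u)"

definition gam :: "2 \<Rightarrow> 2 \<Rightarrow> 2 \<Rightarrow> real ^ 2 \<Rightarrow> real" where
  "gam k i j u = (if k = 1 then H i j 1 u * G 2 2 u - H i j 2 u * G 1 2 u
     else H i j 2 u * G 1 1 u - H i j 1 u * G 1 2 u) / (G 1 1 u * G 2 2 u - G 1 2 u * G 1 2 u)"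

lemma G_sym: "G i j u = G j i u"
  by (simp add: G_def gform_commute)

text \<open>The vector \<open>G\<^sub>2\<^sub>2 \<partial>\<^sub>1 - G\<^sub>1\<^sub>2 \<partial>\<^sub>2\<close> has squared length \<open>G\<^sub>2\<^sub>2\<close> times the Gram determinant.\<close>

lemma gram_det_positive:
  assumes u: "u \<in> S" shows "G 1 1 u * G 2 2 u - G 1 2 u * G 1 2 u > 0"
proof -
  have g: "G 2 2 u > 0" unfolding G_def by (rule positive_X[OF u]) (simp add: axis_eq_0_iff)
  let ?v = "G 2 2 u *\<^sub>R E 1 + (- G 1 2 u) *\<^sub>R E 2"
  have "?v $ 1 \<noteq> 0" using g by (simp add: axis_def)
  then have "?v \<noteq> 0" by (metis zero_index)
  then have "0 < gform (X ?v u) (X ?v u)" by (rule positive_X[OF u])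
  also have "\<dots> = G 2 2 u * (G 1 1 u * G 2 2 u - G 1 2 u * G 1 2 u)"
    unfolding X_add[OF u] X_scaleR[OF u]
    by (simp add: gform.add_left gform.add_right gform.scaleR_left gform.scaleR_right
        gform.minus_left gform.minus_right gform.diff_left gform.diff_right flip: G_def)
       (simp add: G_sym[of 2 1] algebra_simps)
  finally show ?thesis using g by (simp add: zero_less_mult_iff)
qed

lemma covX_expand:
  assumes u: "u \<in> S"
  shows "covX (E i) (E j) u = gam 1 i j u *\<^sub>R X (E 1) u + gam 2 i j u *\<^sub>R X (E 2) u"
proof -
  obtain x :: "real^2" where "covX (E i) (E j) u = X x u"
    using covX_tangent[OF u] by blast
  then have x: "covX (E i) (E j) u = x$1 *\<^sub>R X (E 1) u + x$2 *\<^sub>R X (E 2) u"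
    using X_expand[OF u, of x] by simp
  have "H i j l u = x$1 * G 1 l u + x$2 * G 2 l u" for l
    by (simp add: H_def G_def x gform.add_left gform.scaleR_left)
  then have "gam 1 i j u = x$1" "gam 2 i j u = x$2"
    using gram_det_positive[OF u] by (simp_all add: gam_def G_sym[of 2 1] field_simps)
  then show ?thesis using x by simp
qed

lemma diff_covX: "u \<in> S \<Longrightarrow> covX v w differentiable (at u)"
  unfolding covX_def by (intro differentiable_add diff_DX differentiable_bilinear[OF bounded_bilinear_conn] diff_X)

lemma diff_gam: 
  assumes u: "u \<in> S" shows "gam k i j differentiable (at u)"
proof -
  have g: "(\<lambda>u. G i j u) differentiable (at u)" for i j
    unfolding G_def by (intro differentiable_bilinear[OF bounded_bilinear_gform] diff_X u)
  have h: "(\<lambda>u. H i j l u) differentiable (at u)" for i j l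
    unfolding H_def by (intro differentiable_bilinear[OF bounded_bilinear_gform] diff_X diff_covX u)
  have "(\<lambda>u. gam k i j u) differentiable (at u)"
    unfolding gam_def using gram_det_positive[OF u]
    by (cases "k = 1") (auto intro!: differentiable_divide differentiable_diff differentiable_mult g h)
  then show ?thesis by simp
qed

lemma induced_metric_G: "u \<in> S \<Longrightarrow> induced_metric f u $ i $ j = G i j u"
  by (simp add: induced_metric_def metric_X G_def)

text \<open>The connection is metric, and \<open>conn_metric\<close> allows covariant derivatives in place of ordinary ones.\<close>

lemma partial_G:
  assumes u: "u \<in> S"
  shows "partial l (\<lambda>w. induced_metric f w $ i $ j) u = H l i j u + H l j i u"
proof -
  have d: "(\<lambda>u. G i j u) differentiable (at u)"
    unfolding G_def by (intro differentiable_bilinear[OF bounded_bilinear_gform] diff_X u)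
  have "deriv_at (\<lambda>u. G i j u) u = deriv_at (\<lambda>w. induced_metric f w $ i $ j) u"
    by (rule frechet_derivative_transform_within_open[OF d open_S u]) (simp add: induced_metric_G)
  then have "partial l (\<lambda>w. induced_metric f w $ i $ j) u = deriv_at (\<lambda>u. G i j u) u (E l)"
    by (simp add: partial_def)
  also have "\<dots> = gform (X (E i) u) (deriv_at (X (E j)) u (E l)) + gform (deriv_at (X (E i)) u (E l)) (X (E j) u)"
    unfolding G_def by (rule deriv_at_bilinear[OF bounded_bilinear_gform diff_X[OF u] diff_X[OF u]])
  also have "\<dots> = H l i j u + H l j i u"
    using conn_metric[of "X (E l) u" "X (E i) u" "X (E j) u"]
    by (simp add: H_def covX_def gform.add_left gform_commute[of "X (E i) u"])
  finally show ?thesis .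
qed

text \<open>The restricted connection is torsion-free and metric, and so it is the Levi-Civita connection of the induced
  metric: the three partial derivatives of the metric in the Christoffel symbol combine to \<open>2 H i j l\<close>.\<close>

lemma christoffel_gam:
  assumes u: "u \<in> S" shows "christoffel (induced_metric f) k i j u = gam k i j u"
proof -
  let ?M = "induced_metric f u"
  have det: "det ?M = G 1 1 u * G 2 2 u - G 1 2 u * G 1 2 u"
    by (simp add: det_2 induced_metric_G u G_sym[of 2 1])
  have inv: "matrix_inv ?M = (1 / det ?M) *\<^sub>R adj2 ?M"
    by (rule matrix_inv_adj2) (use gram_det_positive[OF u] det in simp)
  have adj: "adj2 ?M $ 1 $ 1 = G 2 2 u" "adj2 ?M $ 1 $ 2 = - G 1 2 u" 
    "adj2 ?M $ 2 $ 1 = - G 1 2 u" "adj2 ?M $ 2 $ 2 = G 1 1 u"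
    by (simp_all add: adj2_def mat2_simps induced_metric_G u G_sym[of 2 1])
  have *: "partial i (\<lambda>w. induced_metric f w $ j $ l) u + partial j (\<lambda>w. induced_metric f w $ i $ l) u
      - partial l (\<lambda>w. induced_metric f w $ i $ j) u = 2 * H i j l u" for l
    unfolding partial_G[OF u] H_def covX_sym[OF u, of "E j" "E i"] covX_sym[OF u, of "E l" "E i"] covX_sym[OF u, of "E l" "E j"]
    by simp
  have k: "k = 1 \<or> k = 2" using exhaust_2 by auto
  show ?thesis unfolding christoffel_def * inv sum_2 using k
    by (auto simp: adj gam_def det diff_divide_distrib mult_ac)
qed

lemma deriv_covX:
  assumes u: "u \<in> S"
  shows "deriv_at (covX v w) u z = deriv_at (\<lambda>u. deriv_at (X w) u v) u z
     + (conn (X v u) (deriv_at (X w) u z) + conn (deriv_at (X v) u z) (X w u))"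
proof -
  note d1 = diff_DX[OF u, of w v] and d2 = differentiable_bilinear[OF bounded_bilinear_conn diff_X[OF u, of v] diff_X[OF u, of w]]
  show ?thesis
    unfolding covX_def
    by (simp add: deriv_at_eq[OF has_derivative_add[OF has_derivative_deriv_at[OF d1] has_derivative_deriv_at[OF d2]]]
        deriv_at_bilinear[OF bounded_bilinear_conn diff_X[OF u] diff_X[OF u]])
qed

text \<open>The ambient curvature as the commutator of covariant derivatives along the surface. Second
  derivatives of \<open>X w\<close> cancel by symmetry, and the Maurer-Cartan equation yields the bracket term of \<open>curv\<close>.\<close>

lemma curvature_commutation:
  assumes u: "u \<in> S"
  shows "(deriv_at (covX v w) u z + conn (X z u) (covX v w u)) - (deriv_at (covX z w) u v + conn (X v u) (covX z w u))
     = curv (X z u) (X v u) (X w u)"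
proof -
  have "deriv_at (\<lambda>u. deriv_at (X w) u v) u z = deriv_at (\<lambda>u. deriv_at (X w) u z) u v"
    by (rule symmetric_second_derivative[OF open_S smooth_X u])
  moreover have "deriv_at (X v) u z = deriv_at (X z) u v - pbr (X z u) (X v u)"
    using deriv_X_antisym[OF u, of v z] by (simp add: algebra_simps)
  ultimately show ?thesis
    by (simp add: deriv_covX[OF u] covX_def conn.add_right conn.diff_left curv_def)
qed

text \<open>The same second covariant derivative, computed from its expansion in the frame \<open>X\<^sub>1, X\<^sub>2\<close> with the
  Christoffel symbols as coefficients.\<close>

lemma deriv_covX_expand:
  assumes u: "u \<in> S"
  shows "deriv_at (covX (E j) (E k)) u (E i) + conn (X (E i) u) (covX (E j) (E k) u) =
     (deriv_at (gam 1 j k) u (E i) + (gam 1 j k u * gam 1 i 1 u + gam 2 j k u * gam 1 i 2 u)) *\<^sub>R X (E 1) u +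
     (deriv_at (gam 2 j k) u (E i) + (gam 1 j k u * gam 2 i 1 u + gam 2 j k u * gam 2 i 2 u)) *\<^sub>R X (E 2) u"
proof -
  have dl: "(\<lambda>u. gam l j k u *\<^sub>R X (E l) u) differentiable (at u)" for l
    using diff_gam[OF u, of l j k] diff_X[OF u] by (intro differentiable_scaleR) simp_all
  have Dl: "deriv_at (\<lambda>u. gam l j k u *\<^sub>R X (E l) u) u v = gam l j k u *\<^sub>R deriv_at (X (E l)) u v + deriv_at (gam l j k) u v *\<^sub>R X (E l) u" for l v
    by (rule deriv_at_bilinear[OF bounded_bilinear_scaleR diff_gam[OF u] diff_X[OF u]])
  have "deriv_at (covX (E j) (E k)) u = deriv_at (\<lambda>u. gam 1 j k u *\<^sub>R X (E 1) u + gam 2 j k u *\<^sub>R X (E 2) u) u"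
    by (rule frechet_derivative_transform_within_open[OF diff_covX[OF u] open_S u]) (rule covX_expand)
  then have "deriv_at (covX (E j) (E k)) u (E i) =
     (gam 1 j k u *\<^sub>R deriv_at (X (E 1)) u (E i) + deriv_at (gam 1 j k) u (E i) *\<^sub>R X (E 1) u)
     + (gam 2 j k u *\<^sub>R deriv_at (X (E 2)) u (E i) + deriv_at (gam 2 j k) u (E i) *\<^sub>R X (E 2) u)"
    by (simp add: deriv_at_eq[OF has_derivative_add[OF has_derivative_deriv_at[OF dl] has_derivative_deriv_at[OF dl]]] Dl)
  then have "deriv_at (covX (E j) (E k)) u (E i) + conn (X (E i) u) (covX (E j) (E k) u) =
      deriv_at (gam 1 j k) u (E i) *\<^sub>R X (E 1) u + deriv_at (gam 2 j k) u (E i) *\<^sub>R X (E 2) u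
     + (gam 1 j k u *\<^sub>R covX (E i) (E 1) u + gam 2 j k u *\<^sub>R covX (E i) (E 2) u)"
    unfolding covX_expand[OF u, of j k]
    by (simp add: covX_def conn.add_right conn.scaleR_right algebra_simps)
  then show ?thesis unfolding covX_expand[OF u] by (simp add: algebra_simps)
qed

text \<open>The Gauss and Codazzi equations of a totally geodesic surface in one: comparing the two computations of the second covariant
  derivative identifies the intrinsic and the ambient curvature.\<close>

lemma riemann_curv:
  assumes u: "u \<in> S"
  shows "riemann (induced_metric f) 1 i j k u *\<^sub>R X (E 1) u + riemann (induced_metric f) 2 i j k u *\<^sub>R X (E 2) u
     = curv (X (E i) u) (X (E j) u) (X (E k) u)"
proof -
  have p: "partial i (christoffel (induced_metric f) l j k) u = deriv_at (gam l j k) u (E i)" for i l j k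
    unfolding partial_def
    by (rule fun_cong[OF frechet_derivative_transform_within_open[OF diff_gam[OF u] open_S u, symmetric]])
       (simp add: christoffel_gam)
  have r: "riemann (induced_metric f) l i j k u =
     deriv_at (gam l j k) u (E i) - deriv_at (gam l i k) u (E j)
     + ((gam 1 j k u * gam l i 1 u - gam 1 i k u * gam l j 1 u) + (gam 2 j k u * gam l i 2 u - gam 2 i k u * gam l j 2 u))" for l
    by (simp add: riemann_def p christoffel_gam u sum_2)
  show ?thesis
    unfolding curvature_commutation[OF u, symmetric] deriv_covX_expand[OF u] r
    by (simp add: algebra_simps)
qed

text \<open>The vector is orthogonal to \<open>X\<^sub>1\<close> by flatness and to \<open>X\<^sub>2\<close> by \<open>curv_skew\<close>; by \<open>riemann_curv\<close> it is itself a combination of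
  these two, so it is orthogonal to itself.\<close>

lemma curv_zero:
  assumes u: "u \<in> S"
  shows "curv (X (E 1) u) (X (E 2) u) (X (E 2) u) = 0"
proof -
  define R where "R = curv (X (E 1) u) (X (E 2) u) (X (E 2) u)"
  let ?r = "\<lambda>l. riemann (induced_metric f) l 1 2 2 u"
  have R: "R = ?r 1 *\<^sub>R X (E 1) u + ?r 2 *\<^sub>R X (E 2) u"
    unfolding R_def by (rule riemann_curv[OF u, symmetric])
  have "det (induced_metric f u) > 0"
    using gram_det_positive[OF u] by (simp add: det_2 induced_metric_G u G_sym[of 2 1])
  then have "?r 1 * G 1 1 u + ?r 2 * G 2 1 u = 0"
    using flat[OF u] by (simp add: gauss_curvature_def sum_2 induced_metric_G u)
  then have 1: "gform R (X (E 1) u) = 0"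
    by (simp add: R gform.add_left gform.scaleR_left G_def)
  have 2: "gform R (X (E 2) u) = 0" unfolding R_def by (rule curv_skew)
  have "gform R (X v u) = 0" for v
    by (simp add: X_expand[OF u, of v] gform.add_right gform.scaleR_right 1 2)
  moreover have "R = X (?r 1 *\<^sub>R E 1 + ?r 2 *\<^sub>R E 2) u"
    by (simp add: R X_add X_scaleR u)
  ultimately show ?thesis
    using positive_X[OF u, of "?r 1 *\<^sub>R E 1 + ?r 2 *\<^sub>R E 2"] X_scaleR[OF u, of 0] R_def
    by (metis less_irrefl scaleR_zero_left)
qed

text \<open>As \<open>X\<^sub>1 = p X\<^sub>2 + q J X\<^sub>2\<close> with \<open>q \<noteq> 0\<close>, the vanishing of \<open>R(X\<^sub>1, X\<^sub>2)X\<^sub>2\<close> gives that of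
  \<open>R(J X\<^sub>2, X\<^sub>2)X\<^sub>2\<close>.\<close>

lemma components_commute:
  assumes u: "u \<in> S"
  shows "commut (fst (X (E 2) u)) (snd (X (E 2) u)) = 0"
proof -
  let ?x = "X (E 2) u"
  obtain p q where q: "q \<noteq> 0" "X (E 1) u = p *\<^sub>R ?x + q *\<^sub>R Jform ?x"
    using complex_frame(2)[OF u] by blast
  have "curv ?x ?x ?x = 0"
    by (simp add: curv_def pbr_eq conn.zero_left)
  moreover have "curv (p *\<^sub>R x + q *\<^sub>R y) ?x ?x = p *\<^sub>R curv x ?x ?x + q *\<^sub>R curv y ?x ?x" for x y
    by (simp add: curv_def pbr_eq conn.add_left conn.add_right conn.diff_left conn.scaleR_left conn.scaleR_right
        pmul.add_left pmul.add_right pmul.scaleR_left pmul.scaleR_right algebra_simps)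
  ultimately have "curv (Jform ?x) ?x ?x = 0"
    using curv_zero[OF u] q by simp
  moreover have "gform ?x ?x > 0" by (rule positive_X[OF u]) (simp add: axis_eq_0_iff)
  ultimately show ?thesis
    using curv_J_zero_imp_commut[of "fst ?x" "snd ?x"] X_sl2_pairs[OF u, of "E 2"] by simp
qed

end

section \<open>Maps into \<open>SL(2,\<real>)\<close> whose derivative has a constant direction\<close>

lemma diag2_nth [simp]:
  "diag2 a b $ 1 $ 1 = a" "diag2 a b $ 1 $ 2 = 0" "diag2 a b $ 2 $ 1 = 0" "diag2 a b $ 2 $ 2 = b"
  by (simp_all add: diag2_def)

text \<open>The square of \<open>x\<close> is the identity, so its eigenvalues are \<open>\<plusminus>1\<close>; the columns of \<open>c\<close> are eigenvectors, scaled to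
  determinant \<open>1\<close>. For \<open>x = (p, q; r, -p)\<close> the eigenvectors \<open>(1 + p, r)\<close> and \<open>(-q, 1 + p)\<close> are independent only if \<open>p \<noteq> -1\<close>.\<close>

lemma sl2_normal_form:
  assumes "x \<in> sl2" "sl2_form x x = 1"
  shows "\<exists>c\<in>SL2. x = c ** diag2 1 (-1) ** adj2 c"
proof -
  define p q r where "p = x$1$1" and "q = x$1$2" and "r = x$2$1"
  have x22: "x$2$2 = - p" using assms(1) by (simp add: sl2_def trace_def sum_2 p_def)
  have qr: "p * p + q * r = 1"
    using assms(2) by (simp add: sl2_form_def mat2_simps x22 flip: p_def q_def r_def)
  have main: "x = c ** diag2 1 (-1) ** adj2 c" if c: "c \<in> SL2" and e: "x ** c = c ** diag2 1 (-1)" for c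
  proof -
    have "c ** diag2 1 (-1) ** adj2 c = x ** (c ** adj2 c)" by (simp add: e matrix_mul_assoc)
    then show ?thesis using c by (simp add: mult_adj2 SL2_def)
  qed
  have "\<exists>c\<in>SL2. x ** c = c ** diag2 1 (-1)"
  proof (cases "p = -1")
    case True
    define c :: mat2 where "c = vector [vector [q / 2, -1], vector [1, r / 2]]"
    have "q * r = 0" using qr True by simp
    moreover have "c$1$1 = q / 2" "c$1$2 = -1" "c$2$1 = 1" "c$2$2 = r / 2" by (simp_all add: c_def)
    ultimately show ?thesis
      by (intro bexI[of _ c]) (auto simp: SL2_def mat2_simps x22 True simp flip: p_def q_def r_def)
  next
    case False
    define m where "m = 2 + 2 * p"
    have m: "m \<noteq> 0" using False by (auto simp: m_def)
    define c :: mat2 where "c = vector [vector [1 + p, - q / m], vector [r, (1 + p) / m]]"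
    have c: "c$1$1 = 1 + p" "c$1$2 = - q / m" "c$2$1 = r" "c$2$2 = (1 + p) / m" by (simp_all add: c_def)
    have d: "(1 + p) * (1 + p) + q * r = m" using qr by (simp add: m_def algebra_simps)
    have "c \<in> SL2" using m d by (simp add: SL2_def det_2 c add_divide_distrib[symmetric])
    moreover have "x ** c = c ** diag2 1 (-1)"
      using qr m by (simp add: mat2_simps c x22 flip: p_def q_def r_def)
        (simp add: field_simps, metis distrib_left mult.right_neutral)
    ultimately show ?thesis by blast
  qed
  then show ?thesis using main by blast
qed

lemma adj2_mult_cancel: "det A = 1 \<Longrightarrow> adj2 A ** (A ** z) = z"
  by (simp add: matrix_mul_assoc adj2_mult_self)

text \<open>The solutions of \<open>A' = a A x\<close> with a scalar \<open>a\<close> are \<open>A\<^sub>0 exp(tx)\<close>. No differential equation has to be solved to see this: the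
  matrix \<open>A x A\<^sup>-\<^sup>1\<close> has derivative zero, so \<open>A\<^sub>0\<^sup>-\<^sup>1 A\<close> commutes with \<open>x\<close>. After conjugation by \<open>c\<close> it commutes with
  \<open>diag(1,-1)\<close>, hence is diagonal; its entries are positive as they are at \<open>u0\<close>.\<close>

lemma integrate_constant_direction:
  fixes A :: "'a::real_normed_vector \<Rightarrow> mat2"
  assumes B: "convex B" "open B" "u0 \<in> B"
    and diff: "\<And>u. u \<in> B \<Longrightarrow> A differentiable (at u)" and det: "\<And>u. u \<in> B \<Longrightarrow> A u \<in> SL2"
    and c: "c \<in> SL2" and x: "x = c ** diag2 1 (-1) ** adj2 c" and sl: "x \<in> sl2"
    and dA: "\<And>u v. u \<in> B \<Longrightarrow> \<exists>a. deriv_at A u v = a *\<^sub>R (A u ** x)"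
    and u: "u \<in> B"
  defines "m \<equiv> (\<lambda>u. adj2 c ** adj2 (A u0) ** A u ** c)"
  shows "\<exists>t. m u = diag2 (exp t) (exp (- t))"
proof -
  note id = mult_adj2 adj2_mult_self
  have d1: "det c = 1" using c by (simp add: SL2_def)
  have dA1: "det (A u) = 1" if "u \<in> B" for u using det[OF that] by (simp add: SL2_def)
  define K where "K = (\<lambda>u. A u ** (x ** adj2 (A u)))"
  have "(K has_derivative (\<lambda>v. 0)) (at u)" if u: "u \<in> B" for u
  proof -
    have d: "(\<lambda>u. x ** adj2 (A u)) differentiable (at u)"
      and dd: "deriv_at (\<lambda>u. x ** adj2 (A u)) u v = x ** adj2 (deriv_at A u v)" for v
      using bounded_linear_compose[OF mult.bounded_linear_right bounded_linear_adj2] diff[OF u]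
      by (auto simp: o_def intro!: differentiable_linear[of "\<lambda>a. x ** adj2 a"] deriv_at_linear[of "\<lambda>a. x ** adj2 a"])
    have "deriv_at K u v = 0" for v
    proof -
      obtain a where a: "deriv_at A u v = a *\<^sub>R (A u ** x)" using dA[OF u] by blast
      have "adj2 (deriv_at A u v) = - a *\<^sub>R (x ** adj2 (A u))"
        by (simp add: a linear_cmul[OF bounded_linear.linear[OF bounded_linear_adj2]] adj2_mult adj2_sl2[OF sl] mult.minus_left)
      then show ?thesis
        unfolding K_def deriv_at_bilinear[OF bounded_bilinear_mult diff[OF u] d] dd a
        by (simp add: mult.scaleR_left mult.scaleR_right mult.minus_right matrix_mul_assoc)
    qed
    moreover have "K differentiable (at u)"
      unfolding K_def by (rule differentiable_bilinear[OF bounded_bilinear_mult diff[OF u] d])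
    ultimately show ?thesis using has_derivative_deriv_at[of K u] by presburger
  qed
  then obtain k where k: "\<And>u. u \<in> B \<Longrightarrow> K u = k"
    using has_derivative_zero_constant[OF B(1), of K] has_derivative_at_withinI by blast
  have m_diag: "m w $ 1 $ 2 = 0 \<and> m w $ 2 $ 1 = 0" and m_det: "m w $ 1 $ 1 * m w $ 2 $ 2 = 1" if w: "w \<in> B" for w
  proof -
    have "det (m w) = 1" by (simp add: m_def det_mul det_adj2 d1 dA1 B(3) w)
    have "m w ** diag2 1 (-1) = adj2 c ** adj2 (A u0) ** A w ** (c ** diag2 1 (-1) ** adj2 c) ** c"
      by (simp add: m_def d1 id flip: matrix_mul_assoc)
    also have "\<dots> = adj2 c ** adj2 (A u0) ** (A w ** (x ** adj2 (A w))) ** A w ** c"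
      unfolding x[symmetric] by (simp add: adj2_mult_cancel[OF dA1[OF w]] flip: matrix_mul_assoc)
    also have "A w ** (x ** adj2 (A w)) = A u0 ** (x ** adj2 (A u0))"
      using k[OF w] k[OF B(3)] by (simp add: K_def)
    also have "adj2 c ** adj2 (A u0) ** (A u0 ** (x ** adj2 (A u0))) = diag2 1 (-1) ** adj2 c ** adj2 (A u0)"
      unfolding x by (simp add: adj2_mult_cancel d1 dA1[OF B(3)] flip: matrix_mul_assoc)
    finally have com: "m w ** diag2 1 (-1) = diag2 1 (-1) ** m w"
      by (simp add: m_def matrix_mul_assoc)
    from arg_cong[OF com, of "\<lambda>M. M $ 1 $ 2"] arg_cong[OF com, of "\<lambda>M. M $ 2 $ 1"]
    show "m w $ 1 $ 2 = 0 \<and> m w $ 2 $ 1 = 0" by (simp add: matrix_matrix_mult_def sum_2)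
    then show "m w $ 1 $ 1 * m w $ 2 $ 2 = 1" using \<open>det (m w) = 1\<close> by (simp add: det_2)
  qed
  have "continuous_on B (\<lambda>u. m u $ 1 $ 1)"
  proof -
    have "continuous_on B A" using diff
      by (simp add: continuous_at_imp_continuous_on differentiable_imp_continuous_within)
    then show ?thesis unfolding m_def
      by (intro continuous_intros bounded_bilinear.continuous_on[OF bounded_bilinear_mult])
  qed
  then have conn: "connected ((\<lambda>u. m u $ 1 $ 1) ` B)"
    using convex_connected[OF B(1)] connected_continuous_image by blast
  have "m u0 $ 1 $ 1 = 1"
    by (simp add: m_def adj2_mult_cancel id dA1[OF B(3)] d1 flip: matrix_mul_assoc) (simp add: mat_def)
  have "m u $ 1 $ 1 > 0"
  proof (rule ccontr)
    assume "\<not> ?thesis"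
    then have "0 \<in> (\<lambda>u. m u $ 1 $ 1) ` B"
      using connectedD_interval[OF conn, of "m u $ 1 $ 1" "m u0 $ 1 $ 1" 0] u B(3) \<open>m u0 $ 1 $ 1 = 1\<close> by simp
    then show False using m_det by fastforce
  qed
  then show ?thesis using m_diag[OF u] m_det[OF u]
    by (intro exI[of _ "ln (m u $ 1 $ 1)"]) (simp add: vec_eq_iff forall_2 exp_minus inverse_eq_divide eq_divide_eq mult.commute)
qed

section \<open>The split torus\<close>

text \<open>The isometries \<open>(A, B) \<mapsto> (aAc, bBc)\<close>. The right factor is the same on both components, since the mixed terms of \<open>g\<close>
  are preserved only by a simultaneous conjugation of \<open>\<alpha>\<close> and \<open>\<beta>\<close>.\<close>

definition two_sided :: "mat2 \<Rightarrow> mat2 \<Rightarrow> mat2 \<Rightarrow> mat2 \<times> mat2 \<Rightarrow> mat2 \<times> mat2" where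
  "two_sided a b c p = pmul (a, b) (pmul p (c, c))"

definition split_torus :: "(mat2 \<times> mat2) set" where
  "split_torus = {(diag2 (exp s) (exp (- s)), diag2 (exp t) (exp (- t))) | s t. True}"

definition torus_coord :: "mat2 \<times> mat2 \<Rightarrow> real ^ 2" where
  "torus_coord p = vector [ln (fst p $ 1 $ 1), ln (snd p $ 1 $ 1)]"

lemma torus_coord_inverse:
  "p \<in> split_torus \<Longrightarrow> p = (diag2 (exp (torus_coord p $ 1)) (exp (- torus_coord p $ 1)),
     diag2 (exp (torus_coord p $ 2)) (exp (- torus_coord p $ 2)))"
  by (auto simp: split_torus_def torus_coord_def)

lemma continuous_on_torus_coord: "continuous_on split_torus torus_coord"
proof -
  have "torus_coord = (\<lambda>p. \<chi> i::2. if i = 1 then ln (fst p $ 1 $ 1) else ln (snd p $ 1 $ 1))"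
    by (simp add: torus_coord_def fun_eq_iff vec_eq_iff forall_2)
  moreover have c: "continuous_on split_torus (\<lambda>p. ln (fst p $ 1 $ 1))" "continuous_on split_torus (\<lambda>p. ln (snd p $ 1 $ 1))"
    by (intro continuous_intros; auto simp: split_torus_def)+
  have "continuous_on split_torus (\<lambda>p. \<chi> i::2. if i = 1 then ln (fst p $ 1 $ 1) else ln (snd p $ 1 $ 1))"
  proof (rule continuous_on_vec_lambda)
    fix i :: 2
    show "continuous_on split_torus (\<lambda>p. if i = 1 then ln (fst p $ 1 $ 1) else ln (snd p $ 1 $ 1))"
      using c by (cases "i = 1") simp_all
  qed
  ultimately show ?thesis by (simp only:)
qed

text \<open>\<open>torus_coord\<close> is a homeomorphism of the split torus onto the plane.\<close>

lemma openin_torus: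
  assumes "T \<subseteq> split_torus" "open (torus_coord ` T)"
  shows "openin (top_of_set split_torus) T"
proof -
  have "T = split_torus \<inter> torus_coord -` (torus_coord ` T)"
    using assms(1) torus_coord_inverse by (auto simp: subset_iff) metis
  then show ?thesis
    using continuous_openin_preimage_gen[OF continuous_on_torus_coord assms(2)] by simp
qed

section \<open>The surface lies locally in a coset of the split torus\<close>

context flat_chart
begin

lemma common_direction:
  assumes u: "u \<in> S" and h: "h = fst (X (E 2) u) \<or> h = snd (X (E 2) u)" "h \<noteq> 0"
  shows "\<exists>a b. X v u = (a *\<^sub>R h, b *\<^sub>R h)"
proof -
  let ?x = "X (E 2) u"
  have sl: "fst ?x \<in> sl2" "snd ?x \<in> sl2" using X_sl2_pairs[OF u] by (auto simp: mem_Times_iff)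
  have c: "commut (fst ?x) (snd ?x) = 0" "commut (snd ?x) (fst ?x) = 0"
    using components_commute[OF u] commut_anti[of "snd ?x"] by simp_all
  have "\<exists>a b. ?x = (a *\<^sub>R h, b *\<^sub>R h)"
    using h(1)
  proof
    assume *: "h = fst ?x"
    then obtain t where "snd ?x = t *\<^sub>R h" using commut_eq_0D[OF sl c(1)] h(2) by blast
    then show ?thesis using * by (metis prod.collapse scaleR_one)
  next
    assume *: "h = snd ?x"
    then obtain t where "fst ?x = t *\<^sub>R h" using commut_eq_0D[OF sl(2,1) c(2)] h(2) by blast
    then show ?thesis using * by (metis prod.collapse scaleR_one)
  qed
  then obtain a b where ab: "?x = (a *\<^sub>R h, b *\<^sub>R h)" by blast
  obtain p q where "X v u = p *\<^sub>R ?x + q *\<^sub>R Jform ?x" using complex_frame(1)[OF u] by blast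
  then have "X v u = ((p * a + q * ((a - 2 * b) / sqrt 3)) *\<^sub>R h, (p * b + q * ((2 * a - b) / sqrt 3)) *\<^sub>R h)"
    by (simp add: ab Jform_def algebra_simps diff_divide_distrib scaleR_diff_left)
  then show ?thesis by blast
qed

text \<open>On a pair \<open>(ah, bh)\<close> the form \<open>gform\<close> is \<open>\<langle>h,h\<rangle>\<close> times a positive semidefinite quadratic form in \<open>a, b\<close>.\<close>

lemma direction_positive:
  assumes u: "u \<in> S" and x: "X (E 2) u = (a *\<^sub>R h, b *\<^sub>R h)"
  shows "sl2_form h h > 0"
proof -
  have "gform (X (E 2) u) (X (E 2) u) > 0" by (rule positive_X[OF u]) (simp add: axis_eq_0_iff)
  then have "2 / 3 * (a\<^sup>2 + b\<^sup>2 - a * b) * sl2_form h h > 0"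
    by (simp add: x gform_def sl2_form.scaleR_left sl2_form.scaleR_right power2_eq_square algebra_simps)
  moreover have "a\<^sup>2 + b\<^sup>2 - a * b \<ge> 0"
  proof -
    have "a\<^sup>2 + b\<^sup>2 - a * b = (a - b / 2)\<^sup>2 + 3 / 4 * b\<^sup>2"
      by (simp add: power2_eq_square field_simps)
    then show ?thesis by simp
  qed
  ultimately show ?thesis by (simp add: zero_less_mult_iff)
qed

text \<open>\<open>conn\<close> is made of commutators, which vanish on a plane of pairs \<open>(ah, bh)\<close>; so here the ordinary derivative
  is the covariant one, and it is tangent to the surface.\<close>

lemma deriv_in_direction:
  assumes u: "u \<in> S" and h: "h = fst (X (E 2) u) \<or> h = snd (X (E 2) u)" "h \<noteq> 0"
  shows "\<exists>a b. deriv_at (X (E 2)) u v = (a *\<^sub>R h, b *\<^sub>R h)"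
proof -
  obtain a b where ab: "X (E 2) u = (a *\<^sub>R h, b *\<^sub>R h)" using common_direction[OF assms] by blast
  obtain c d where cd: "X v u = (c *\<^sub>R h, d *\<^sub>R h)" using common_direction[OF assms] by blast
  have "commut h h = 0" by (simp add: commut_def)
  then have "conn (X v u) (X (E 2) u) = 0"
    by (simp add: conn_def pbr_def ab cd commut.scaleR_left commut.scaleR_right zero_prod_def)
  then have "deriv_at (X (E 2)) u v = covX v (E 2) u" by (simp add: covX_def)
  then show ?thesis using covX_tangent[OF u, of v "E 2"] common_direction[OF assms] by metis
qed

text \<open>One component \<open>h\<close> of \<open>X\<^sub>2\<close> is nonzero near \<open>u0\<close>. Its derivatives are multiples of \<open>h\<close>, so that \<open>h / sqrt \<langle>h,h\<rangle>\<close> has derivative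
  zero.\<close>

lemma constant_direction:
  assumes u0: "u0 \<in> S"
  shows "\<exists>r>0. \<exists>x\<in>sl2. ball u0 r \<subseteq> S \<and> sl2_form x x = 1 \<and> (\<forall>u\<in>ball u0 r. \<forall>v. \<exists>a b. X v u = (a *\<^sub>R x, b *\<^sub>R x))"
proof -
  have "gform (X (E 2) u0) (X (E 2) u0) > 0" by (rule positive_X[OF u0]) (simp add: axis_eq_0_iff)
  then have "X (E 2) u0 \<noteq> 0" by (auto simp: gform.zero_left)
  then obtain pr :: "mat2 \<times> mat2 \<Rightarrow> mat2" where pr: "pr = fst \<or> pr = snd" "pr (X (E 2) u0) \<noteq> 0"
    by (metis prod_eq_iff fst_zero snd_zero)
  have L: "bounded_linear pr" using pr(1) bounded_linear_fst bounded_linear_snd by auto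
  define h where "h = (\<lambda>u. pr (X (E 2) u))"
  have dh: "h differentiable (at u)" and Dh: "deriv_at h u v = pr (deriv_at (X (E 2)) u v)" if "u \<in> S" for u v
    unfolding h_def by (intro differentiable_linear[OF L] deriv_at_linear[OF L] diff_X that)+
  have ch: "continuous_on S h"
    using dh by (simp add: continuous_at_imp_continuous_on differentiable_imp_continuous_within)
  have "open (S \<inter> h -` (- {0}))" by (rule continuous_open_preimage[OF ch open_S]) auto
  moreover have "u0 \<in> S \<inter> h -` (- {0})" using u0 pr(2) by (simp add: h_def)
  ultimately obtain r where r: "r > 0" "ball u0 r \<subseteq> S \<inter> h -` (- {0})"
    using open_contains_ball by blast
  have uS: "u \<in> S" and h0: "h u \<noteq> 0" and hor: "h u = fst (X (E 2) u) \<or> h u = snd (X (E 2) u)" if "u \<in> ball u0 r" for u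
    using r(2) that pr(1) by (auto simp: h_def)
  define n where "n = (\<lambda>u. sl2_form (h u) (h u))"
  have n_eq: "sl2_form (h u) (h u) = n u" for u by (simp add: n_def)
  have npos: "n u > 0" if "u \<in> ball u0 r" for u
    using common_direction[OF uS[OF that] hor[OF that] h0[OF that]] direction_positive[OF uS[OF that]] unfolding n_def by blast
  define x where "x = (\<lambda>u. (1 / sqrt (n u)) *\<^sub>R h u)"
  have "(x has_derivative (\<lambda>v. 0)) (at u)" if u: "u \<in> ball u0 r" for u
  proof -
    note hd = has_derivative_deriv_at[OF dh[OF uS[OF u]]]
    have nd: "(n has_derivative (\<lambda>v. sl2_form (h u) (deriv_at h u v) + sl2_form (deriv_at h u v) (h u))) (at u)"
      unfolding n_def by (rule bounded_bilinear.FDERIV[OF bounded_bilinear_sl2_form hd hd])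
    have "((\<lambda>t. 1 / sqrt t) has_real_derivative - 1 / (2 * n u * sqrt (n u))) (at (n u))"
      using npos[OF u] by (auto intro!: derivative_eq_intros simp: field_simps)
    from DERIV_compose_FDERIV[OF this nd]
    have "((\<lambda>u. 1 / sqrt (n u)) has_derivative (\<lambda>v. (sl2_form (h u) (deriv_at h u v) + sl2_form (deriv_at h u v) (h u)) * (- 1 / (2 * n u * sqrt (n u))))) (at u)" .
    from has_derivative_scaleR[OF this hd]
    have "(x has_derivative (\<lambda>v. (1 / sqrt (n u)) *\<^sub>R deriv_at h u v
        + ((sl2_form (h u) (deriv_at h u v) + sl2_form (deriv_at h u v) (h u)) * (- 1 / (2 * n u * sqrt (n u)))) *\<^sub>R h u)) (at u)"
      unfolding x_def .
    moreover have "(1 / sqrt (n u)) *\<^sub>R deriv_at h u v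
        + ((sl2_form (h u) (deriv_at h u v) + sl2_form (deriv_at h u v) (h u)) * (- 1 / (2 * n u * sqrt (n u)))) *\<^sub>R h u = 0" for v
    proof -
      have "\<exists>k. deriv_at h u v = k *\<^sub>R h u"
        using deriv_in_direction[OF uS[OF u] hor[OF u] h0[OF u], of v] pr(1) Dh[OF uS[OF u], of v]
        by (elim exE disjE) simp_all
      then obtain k where k: "deriv_at h u v = k *\<^sub>R h u" by blast
      have "(1 / sqrt (n u)) * k + (k * n u + k * n u) * (- 1 / (2 * n u * sqrt (n u))) = 0"
        using npos[OF u] by (simp add: field_simps)
      then show ?thesis
        by (simp only: k sl2_form.scaleR_left sl2_form.scaleR_right real_scaleR_def n_eq scaleR_scaleR
          scaleR_add_left[symmetric] scaleR_zero_left)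
    qed
    ultimately show ?thesis by (simp only:)
  qed
  then obtain y where y: "\<And>u. u \<in> ball u0 r \<Longrightarrow> x u = y"
    using has_derivative_zero_constant[OF convex_ball, of u0 r x] has_derivative_at_withinI by blast
  have yh: "h u = sqrt (n u) *\<^sub>R y" if "u \<in> ball u0 r" for u
    using npos[OF that] by (simp add: x_def flip: y[OF that])
  have c: "u0 \<in> ball u0 r" using r by simp
  have "h u0 \<in> sl2" using X_sl2_pairs[OF u0] pr(1) by (auto simp: h_def mem_Times_iff)
  then have "y \<in> sl2" unfolding y[OF c, symmetric] x_def by (rule subspace_scale[OF subspace_sl2])
  moreover have "sl2_form y y = 1"
    using npos[OF c] unfolding y[OF c, symmetric] x_def
    by (simp add: sl2_form.scaleR_left sl2_form.scaleR_right n_eq)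
  moreover have "\<exists>a b. X v u = (a *\<^sub>R y, b *\<^sub>R y)" if u: "u \<in> ball u0 r" for u v
    using common_direction[OF uS[OF u] hor[OF u] h0[OF u], of v] unfolding yh[OF u] scaleR_scaleR by blast
  ultimately show ?thesis using r by blast
qed

text \<open>With \<open>c\<close> diagonalising the constant direction, the isometry that moves \<open>f u0\<close> to the identity and conjugates by \<open>c\<close>
  sends a ball into the split torus. In the coordinates of the torus the derivative of this map takes \<open>v\<close> to \<open>(k, l)\<close>, where
  \<open>X v = (kx, lx)\<close>; it is injective, so the map is open.\<close>

lemma local_torus:
  assumes u0: "u0 \<in> S"
  shows "\<exists>r>0. \<exists>a\<in>SL2. \<exists>b\<in>SL2. \<exists>c\<in>SL2. ball u0 r \<subseteq> S \<and>
    (\<forall>W. open W \<and> W \<subseteq> ball u0 r \<longrightarrow> openin (top_of_set split_torus) (two_sided a b c ` f ` W))"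
proof -
  obtain r x where r: "r > 0" "ball u0 r \<subseteq> S" and x: "x \<in> sl2" "sl2_form x x = 1"
    and Xx: "\<And>u v. u \<in> ball u0 r \<Longrightarrow> \<exists>a b. X v u = (a *\<^sub>R x, b *\<^sub>R x)"
    using constant_direction[OF u0] by metis
  obtain c where c: "c \<in> SL2" "x = c ** diag2 1 (-1) ** adj2 c"
    using sl2_normal_form[OF x] by blast
  define a where "a = adj2 c ** adj2 (fst (f u0))"
  define b where "b = adj2 c ** adj2 (snd (f u0))"
  have uS: "u \<in> S" if "u \<in> ball u0 r" for u using r that by blast
  have u0r: "u0 \<in> ball u0 r" using r by simp
  have f_SL2: "fst (f u) \<in> SL2" "snd (f u) \<in> SL2" if "u \<in> ball u0 r" for u
    using f_SLSL[OF uS[OF that]] by (auto simp: SLSL_def mem_Times_iff)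
  have adj_SL2: "adj2 A \<in> SL2" if "A \<in> SL2" for A using that by (simp add: SL2_def det_adj2)
  have ab: "a \<in> SL2" "b \<in> SL2" unfolding a_def b_def by (intro SL2_mult adj_SL2 c f_SL2 u0r)+
  have df: "deriv_at f u v = (fst (f u) ** fst (X v u), snd (f u) ** snd (X v u))" if "u \<in> ball u0 r" for u v
    using pmul_X[OF uS[OF that], of v] by (simp add: pmul_def)
  have L: "bounded_linear (fst :: mat2 \<times> mat2 \<Rightarrow> mat2)" "bounded_linear (snd :: mat2 \<times> mat2 \<Rightarrow> mat2)"
    by (rule bounded_linear_fst bounded_linear_snd)+
  define m where "m = (\<lambda>u. two_sided a b c (f u))"
  have m: "m u = (a ** fst (f u) ** c, b ** snd (f u) ** c)" for u
    by (simp add: m_def two_sided_def pmul_def matrix_mul_assoc)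
  have "\<exists>t. fst (m u) = diag2 (exp t) (exp (- t))" if u: "u \<in> ball u0 r" for u
    unfolding m a_def fst_conv
  proof (rule integrate_constant_direction[OF convex_ball open_ball u0r _ _ c x(1) _ u])
    show "\<exists>k. deriv_at (\<lambda>u. fst (f u)) u v = k *\<^sub>R (fst (f u) ** x)" if u: "u \<in> ball u0 r" for u v
      using Xx[OF u, of v] by (auto simp: deriv_at_linear[OF L(1) diff_f[OF uS[OF u]]] df[OF u] mult.scaleR_right)
  qed (rule f_SL2 differentiable_linear[OF L(1) diff_f[OF uS]], assumption)+
  moreover have "\<exists>t. snd (m u) = diag2 (exp t) (exp (- t))" if u: "u \<in> ball u0 r" for u
    unfolding m b_def snd_conv
  proof (rule integrate_constant_direction[OF convex_ball open_ball u0r _ _ c x(1) _ u])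
    show "\<exists>k. deriv_at (\<lambda>u. snd (f u)) u v = k *\<^sub>R (snd (f u) ** x)" if u: "u \<in> ball u0 r" for u v
      using Xx[OF u, of v] by (auto simp: deriv_at_linear[OF L(2) diff_f[OF uS[OF u]]] df[OF u] mult.scaleR_right)
  qed (rule f_SL2 differentiable_linear[OF L(2) diff_f[OF uS]], assumption)+
  ultimately have m_torus: "m u \<in> split_torus" if "u \<in> ball u0 r" for u
    using that unfolding split_torus_def by (metis (mono_tags, lifting) mem_Collect_eq prod.collapse)
  have dm: "(m has_derivative (\<lambda>v. two_sided a b c (deriv_at f u v))) (at u)" if u: "u \<in> ball u0 r" for u
    unfolding m_def two_sided_def
    by (intro bounded_linear.has_derivative[OF pmul.bounded_linear_right] 
        bounded_linear.has_derivative[OF pmul.bounded_linear_left] has_derivative_deriv_at diff_f uS u)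
  have dm_entry: "two_sided a b c (deriv_at f u v) = (k *\<^sub>R (fst (m u) ** diag2 1 (-1)), l *\<^sub>R (snd (m u) ** diag2 1 (-1)))"
    if u: "u \<in> ball u0 r" and kl: "X v u = (k *\<^sub>R x, l *\<^sub>R x)" for u v k l
  proof -
    have "x ** c = c ** diag2 1 (-1)"
      using c by (simp add: SL2_def adj2_mult_self flip: matrix_mul_assoc)
    then show ?thesis
      by (simp add: m df[OF u] kl two_sided_def pmul_def mult.scaleR_left mult.scaleR_right flip: matrix_mul_assoc)
  qed
  define h where "h = (\<lambda>u. torus_coord (m u))"
  define h' where "h' = (\<lambda>u v. vector [fst (two_sided a b c (deriv_at f u v)) $ 1 $ 1 / fst (m u) $ 1 $ 1,
      snd (two_sided a b c (deriv_at f u v)) $ 1 $ 1 / snd (m u) $ 1 $ 1] :: real ^ 2)"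
  have mpos: "fst (m u) $ 1 $ 1 > 0" "snd (m u) $ 1 $ 1 > 0" if u: "u \<in> ball u0 r" for u
    using m_torus[OF u] by (auto simp: split_torus_def)
  have dh: "(h has_derivative h' u) (at u)" if u: "u \<in> ball u0 r" for u
  proof -
    have entry: "bounded_linear (\<lambda>A::mat2. A $ 1 $ 1)"
      by (rule bounded_linear_compose[OF bounded_linear_vec_nth bounded_linear_vec_nth])
    have "((\<lambda>u. ln (pr (m u) $ 1 $ 1)) has_derivative (\<lambda>v. pr (two_sided a b c (deriv_at f u v)) $ 1 $ 1 / pr (m u) $ 1 $ 1)) (at u)"
      if "bounded_linear pr" "pr (m u) $ 1 $ 1 > 0" for pr :: "mat2 \<times> mat2 \<Rightarrow> mat2"
      using DERIV_compose_FDERIV[OF DERIV_ln[OF that(2)] bounded_linear.has_derivative[OF bounded_linear_compose[OF entry that(1)] dm[OF u]]]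
      by (simp add: divide_inverse)
    note this[OF L(1) mpos(1)[OF u]] this[OF L(2) mpos(2)[OF u]]
    then have "((\<lambda>u. h u $ i) has_derivative (\<lambda>v. h' u v $ i)) (at u)" for i
      using exhaust_2[of i] by (auto simp: h_def h'_def torus_coord_def)
    then show ?thesis
      by (subst has_derivative_componentwise_within) (auto simp: Basis_vec_def inner_axis)
  qed
  have h'_inj: "inj (h' u)" and h'_lin: "linear (h' u)" if u: "u \<in> ball u0 r" for u
  proof -
    show lin: "linear (h' u)" by (rule has_derivative_linear[OF dh[OF u]])
    have "v = 0" if "h' u v = 0" for v
    proof -
      obtain k l where kl: "X v u = (k *\<^sub>R x, l *\<^sub>R x)" using Xx[OF u] by blast
      have "h' u v $ 1 = k" "h' u v $ 2 = l"
        using mpos[OF u] by (simp_all add: h'_def dm_entry[OF u kl] matrix_matrix_mult_def sum_2)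
      then have "X v u = 0" using that by (simp add: kl zero_prod_def)
      then show "v = 0" using positive_X[OF uS[OF u], of v] by (metis gform.zero_left less_irrefl)
    qed
    then show "inj (h' u)" using linear_injective_0[OF lin] by blast
  qed
  have "openin (top_of_set split_torus) (two_sided a b c ` f ` W)" if W: "open W" "W \<subseteq> ball u0 r" for W
  proof (rule openin_torus)
    show "two_sided a b c ` f ` W \<subseteq> split_torus" using m_torus W(2) by (auto simp: m_def)
    have "h w \<in> interior (h ` W)" if w: "w \<in> W" for w
    proof -
      have wr: "w \<in> ball u0 r" using W(2) w by blast
      obtain g where g: "linear g" "h' w \<circ> g = id"
        using linear_injective_isomorphism[OF h'_lin[OF wr] h'_inj[OF wr]] by (auto simp: fun_eq_iff)
      show ?thesis
      proof (rule sussmann_open_mapping[OF open_ball _ wr dh[OF wr] _ g(2) W(2)])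
        show "continuous_on (ball u0 r) h"
          using dh by (meson continuous_at_imp_continuous_on has_derivative_continuous)
        show "bounded_linear g" using g(1) by (simp add: linear_conv_bounded_linear)
        show "w \<in> interior W" using W(1) w by (simp add: interior_open)
      qed
    qed
    then have "open (h ` W)" by (metis image_subsetI interior_subset open_interior subset_antisym)
    then show "open (torus_coord ` two_sided a b c ` f ` W)"
      by (simp add: h_def m_def image_image)
  qed
  then show ?thesis using r ab c(1) by blast
qed

end

section \<open>Congruence of the pieces\<close>

lemma bounded_linear_two_sided: "bounded_linear (two_sided a b c)"
  unfolding two_sided_def
  by (rule bounded_linear_compose[OF pmul.bounded_linear_right pmul.bounded_linear_left])

lemma deriv_two_sided: "deriv_at (two_sided a b c) p v = two_sided a b c v"
  by (rule deriv_at_eq[OF bounded_linear_imp_has_derivative[OF bounded_linear_two_sided]])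

lemma adj2_SL2: "a \<in> SL2 \<Longrightarrow> adj2 a \<in> SL2"
  by (simp add: SL2_def det_adj2)

lemma two_sided_SLSL: "a \<in> SL2 \<Longrightarrow> b \<in> SL2 \<Longrightarrow> c \<in> SL2 \<Longrightarrow> p \<in> SLSL \<Longrightarrow> two_sided a b c p \<in> SLSL"
  unfolding two_sided_def by (intro SLSL_pmul) (auto simp: SLSL_def)

lemma two_sided_compose: "two_sided a b c (two_sided a' b' c' p) = two_sided (a ** a') (b ** b') (c' ** c) p"
  by (simp add: two_sided_def pmul_def matrix_mul_assoc)

lemma two_sided_inverse:
  assumes "a \<in> SL2" "b \<in> SL2" "c \<in> SL2"
  shows "two_sided (adj2 a) (adj2 b) (adj2 c) (two_sided a b c p) = p" "two_sided a b c (two_sided (adj2 a) (adj2 b) (adj2 c) p) = p"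
  using assms by (simp_all add: two_sided_compose SL2_def mult_adj2 adj2_mult_self) (simp_all add: two_sided_def)

text \<open>The trace form is invariant under conjugation, and both components are conjugated by the same matrix.\<close>

lemma gform_conj:
  assumes c: "(c, c) \<in> SLSL"
  shows "gform (pmul (padj (c, c)) (pmul x (c, c))) (pmul (padj (c, c)) (pmul y (c, c))) = gform x y"
proof -
  have "sl2_form (adj2 c ** (a ** c)) (adj2 c ** (b ** c)) = sl2_form a b" if c: "c \<in> SL2" for c a b
  proof -
    have "adj2 c ** (a ** c) ** (adj2 c ** (b ** c)) = adj2 c ** (a ** ((c ** adj2 c) ** (b ** c)))"
      by (simp only: matrix_mul_assoc)
    also have "\<dots> = adj2 c ** (a ** b ** c)"
      using c by (simp add: mult_adj2 SL2_def matrix_mul_assoc)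
    also have "trace \<dots> = trace (a ** b ** c ** adj2 c)"
      by (subst trace_mul_sym) (rule refl)
    also have "a ** b ** c ** adj2 c = a ** b ** (c ** adj2 c)" by (simp only: matrix_mul_assoc)
    also have "\<dots> = a ** b" using c by (simp add: mult_adj2 SL2_def)
    finally show ?thesis by (simp add: sl2_form_def)
  qed
  then show ?thesis using c by (auto simp: gform_def pmul_def padj_def SLSL_def)
qed

text \<open>Left translations leave the trivialised vectors as they are, and the right translation by \<open>(c, c)\<close> conjugates both
  components by \<open>c\<close>.\<close>

lemma two_sided_isometry:
  assumes "a \<in> SL2" "b \<in> SL2" "c \<in> SL2"
  shows "ambient_isometry (two_sided a b c)"
proof -
  let ?\<Psi> = "two_sided (adj2 a) (adj2 b) (adj2 c)"
  note inv = two_sided_inverse[OF assms] and adj = assms[THEN adj2_SL2]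
  have "bij_betw (two_sided a b c) SLSL SLSL"
    by (rule bij_betw_byWitness[of _ ?\<Psi>]) (auto simp: inv assms adj two_sided_SLSL)
  moreover have "metric_g (two_sided a b c p) (deriv_at (two_sided a b c) p v) (deriv_at (two_sided a b c) p w) = metric_g p v w"
    if p: "p \<in> SLSL" for p v w
  proof -
    have ab: "(a, b) \<in> SLSL" and cc: "(c, c) \<in> SLSL" using assms by (auto simp: SLSL_def)
    have "pmul (padj (two_sided a b c p)) (two_sided a b c v) = pmul (padj (c, c)) (pmul (pmul (padj p) v) (c, c))" for v
      by (simp add: two_sided_def padj_pmul pmul_assoc padj_pmul_cancel[OF ab])
    then show ?thesis
      by (simp add: metric_g_gform p two_sided_SLSL assms deriv_two_sided gform_conj[OF cc])
  qed
  moreover have "smooth_on UNIV (two_sided a b c)" "smooth_on UNIV ?\<Psi>"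
    by (intro smooth_on_bounded_linear bounded_linear_two_sided)+
  ultimately show ?thesis
    unfolding ambient_isometry_def using inv(1) open_UNIV subset_UNIV by metis
qed

lemma torus_iff:
  "(A, B) \<in> split_torus \<longleftrightarrow> (\<exists>s. A = diag2 (exp s) (exp (- s))) \<and> (\<exists>t. B = diag2 (exp t) (exp (- t)))"
  by (auto simp: split_torus_def)

lemma SL2_torus: "diag2 (exp s) (exp (- s)) \<in> SL2"
  by (simp add: SL2_def det_2 flip: exp_add)

lemma exp_pair_zero:
  fixes p q s t :: real
  assumes "p * exp s + q * exp (- s) = 0" "p * exp t + q * exp (- t) = 0" "s \<noteq> t"
  shows "p = 0 \<and> q = 0"
proof -
  have e: "p * exp (2 * s) + q = 0" if "p * exp s + q * exp (- s) = 0" for s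
  proof -
    have "exp s * (p * exp s + q * exp (- s)) = p * (exp s * exp s) + q * (exp s * exp (- s))"
      by (simp add: algebra_simps)
    then show ?thesis using that by (simp flip: exp_add)
  qed
  have "p * (exp (2 * s) - exp (2 * t)) = 0"
    using e[OF assms(1)] e[OF assms(2)] unfolding right_diff_distrib by linarith
  then have "p = 0" using assms(3) by simp
  then show ?thesis using assms(1) by simp
qed

text \<open>The entries of \<open>a diag(e\<^sup>w, e\<^sup>-\<^sup>w) c\<close> are combinations of \<open>e\<^sup>w\<close> and \<open>e\<^sup>-\<^sup>w\<close>. If the off-diagonal ones vanish for two
  values of \<open>w\<close>, their coefficients are zero. Then \<open>a\<close> and \<open>c\<close> are both diagonal or both antidiagonal, so each
  diagonal entry is a single exponential, whose sign does not depend on \<open>w\<close>.\<close>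

lemma diagonal_rigid:
  assumes "a \<in> SL2" "c \<in> SL2" "s \<noteq> t"
    and "\<exists>s'. a ** diag2 (exp s) (exp (- s)) ** c = diag2 (exp s') (exp (- s'))"
    and "\<exists>s'. a ** diag2 (exp t) (exp (- t)) ** c = diag2 (exp s') (exp (- s'))"
  shows "\<exists>s'. a ** diag2 (exp w) (exp (- w)) ** c = diag2 (exp s') (exp (- s'))"
proof -
  let ?m = "\<lambda>w. a ** diag2 (exp w) (exp (- w)) ** c"
  have e: "?m w $ i $ j = (a$i$1 * c$1$j) * exp w + (a$i$2 * c$2$j) * exp (- w)" for w i j
    by (simp add: matrix_matrix_mult_def sum_2)
  have z: "a$i$1 * c$1$j = 0 \<and> a$i$2 * c$2$j = 0" if "i \<noteq> j" for i j
  proof (rule exp_pair_zero[OF _ _ assms(3)])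
    have "?m s $ i $ j = 0" "?m t $ i $ j = 0"
      using assms(4,5) that exhaust_2[of i] exhaust_2[of j] by auto
    then show "a$i$1 * c$1$j * exp s + a$i$2 * c$2$j * exp (- s) = 0"
      "a$i$1 * c$1$j * exp t + a$i$2 * c$2$j * exp (- t) = 0" by (simp_all only: e)
  qed
  have off: "?m w $ 1 $ 2 = 0" "?m w $ 2 $ 1 = 0" using z[of 1 2] z[of 2 1] by (auto simp: e)
  have "?m s $ 1 $ 1 > 0" using assms(4) by auto
  then have pos: "a$1$1 * c$1$1 * exp s + a$1$2 * c$2$1 * exp (- s) > 0" by (simp only: e)
  have one: "a$1$1 * c$1$1 = 0 \<or> a$1$2 * c$2$1 = 0"
  proof (rule ccontr)
    assume "\<not> ?thesis"
    then have "c$1$2 = 0" "c$2$2 = 0" using z[of 1 2] by auto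
    then show False using assms(2) by (simp add: SL2_def det_2)
  qed
  then have "?m w $ 1 $ 1 > 0" using pos by (auto simp: e zero_less_mult_iff)
  moreover have "det (?m w) = 1"
    using assms(1,2) SL2_torus[of w] by (simp add: SL2_def det_mul)
  then have "?m w $ 1 $ 1 * ?m w $ 2 $ 2 = 1" using off by (simp add: det_2)
  ultimately show ?thesis
    using off by (intro exI[of _ "ln (?m w $ 1 $ 1)"])
      (simp add: vec_eq_iff forall_2 exp_minus inverse_eq_divide eq_divide_eq mult.commute)
qed

lemma continuous_torus_param: "continuous_on UNIV (\<lambda>t. diag2 (exp t) (exp (- t)))"
proof -
  have "diag2 (exp t) (exp (- t)) = exp t *\<^sub>R diag2 1 0 + exp (- t) *\<^sub>R diag2 0 1" for t
    by (simp add: vec_eq_iff forall_2)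
  then show ?thesis by (simp add: continuous_intros)
qed

text \<open>An open piece of the torus contains two points that differ in the first coordinate only and two that differ in the second
  only; \<open>diagonal_rigid\<close> applies to each factor.\<close>

lemma torus_rigid:
  assumes abc: "a \<in> SL2" "b \<in> SL2" "c \<in> SL2"
    and Ob: "openin (top_of_set split_torus) Ob" "Ob \<noteq> {}" "two_sided a b c ` Ob \<subseteq> split_torus"
  shows "two_sided a b c ` split_torus \<subseteq> split_torus"
proof -
  let ?D = "\<lambda>t. diag2 (exp t) (exp (- t))"
  obtain T where T: "open T" "Ob = split_torus \<inter> T" using Ob(1) by (auto simp: openin_open)
  obtain s t where st: "(?D s, ?D t) \<in> T" using Ob(2) T(2) by (auto simp: split_torus_def)
  have near: "\<exists>e>0. g e \<in> T" if "continuous_on UNIV g" and "g 0 \<in> T" for g :: "real \<Rightarrow> mat2 \<times> mat2"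
  proof -
    have "open (g -` T)" using that(1) T(1) by (simp add: continuous_on_open_vimage)
    moreover have "0 \<in> g -` T" using that(2) by simp
    ultimately obtain d where d: "d > 0" "ball 0 d \<subseteq> g -` T" using open_contains_ball by blast
    then have "d / 2 \<in> g -` T" by (intro subsetD[OF d(2)]) simp
    then show ?thesis using d(1) by (intro exI[of _ "d / 2"]) simp
  qed
  have cont: "continuous_on UNIV (\<lambda>e. ?D (s + e))" for s
    by (rule continuous_on_compose2[OF continuous_torus_param]) (auto intro: continuous_intros)
  obtain e1 where e1: "e1 > 0" "(?D (s + e1), ?D t) \<in> T"
    using near[OF continuous_on_Pair[OF cont[of s] continuous_on_const[of UNIV "?D t"]]] st by auto
  obtain e2 where e2: "e2 > 0" "(?D s, ?D (t + e2)) \<in> T"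
    using near[OF continuous_on_Pair[OF continuous_on_const[of UNIV "?D s"] cont[of t]]] st by auto
  have im: "(a ** A ** c, b ** B ** c) \<in> split_torus" if "(A, B) \<in> T" "(A, B) \<in> split_torus" for A B
  proof -
    have "two_sided a b c (A, B) \<in> split_torus" using that T(2) Ob(3) by blast
    then show ?thesis by (simp add: two_sided_def pmul_def matrix_mul_assoc)
  qed
  have D: "(?D s, ?D t) \<in> split_torus" for s t by (auto simp: split_torus_def)
  note at0 = im[OF st D, unfolded torus_iff]
  note at1 = im[OF e1(2) D, unfolded torus_iff] and at2 = im[OF e2(2) D, unfolded torus_iff]
  have 1: "\<exists>s'. a ** ?D w ** c = ?D s'" for w
    by (rule diagonal_rigid[OF abc(1,3) _ at0[THEN conjunct1] at1[THEN conjunct1]]) (use e1(1) in simp)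
  have 2: "\<exists>s'. b ** ?D w ** c = ?D s'" for w
    by (rule diagonal_rigid[OF abc(2,3) _ at0[THEN conjunct2] at2[THEN conjunct2]]) (use e2(1) in simp)
  show ?thesis
    using 1 2 by (auto simp: split_torus_def two_sided_def pmul_def matrix_mul_assoc)
qed

text \<open>The exponents \<open>(\<surd>3 s - t) / \<surd>2\<close> and \<open>(\<surd>3 s + t) / \<surd>2\<close> are linear coordinates on the plane.\<close>

lemma flat_torus: "range (\<lambda>(s, t). (flat_A s t, flat_B s t)) = split_torus"
proof (intro equalityI subsetI)
  fix x assume "x \<in> range (\<lambda>(s, t). (flat_A s t, flat_B s t))"
  then show "x \<in> split_torus" by (auto simp: split_torus_def flat_A_def flat_B_def)
next
  fix x assume "x \<in> split_torus"
  then obtain p q where x: "x = (diag2 (exp p) (exp (- p)), diag2 (exp q) (exp (- q)))"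
    by (auto simp: split_torus_def)
  define s where "s = sqrt 2 * (p + q) / (2 * sqrt 3)"
  define t where "t = sqrt 2 * (q - p) / 2"
  have "1 / sqrt 2 * (sqrt 3 * s - t) = p" "1 / sqrt 2 * (sqrt 3 * s + t) = q"
    by (simp_all add: s_def t_def field_simps)
  then have "x = (flat_A s t, flat_B s t)"
    by (simp add: x flat_A_def flat_B_def)
  then show "x \<in> range (\<lambda>(s, t). (flat_A s t, flat_B s t))" by auto
qed

text \<open>The chart is a homeomorphism onto an open subset of the plane, which transports \<open>local_torus\<close> from the
  chart image to the surface.\<close>

lemma surface_local_torus:
  fixes M :: "'m topology" and \<A> :: "('m, 2) chart set"
  assumes acs: "almost_complex_surface M \<A> F"
    and pos: "positive_definite_induced_metric \<A> F"
    and tg: "totally_geodesic \<A> F"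
    and flat: "flat_surface \<A> F"
    and p: "p \<in> topspace M"
  shows "\<exists>U. openin M U \<and> p \<in> U \<and> (\<exists>a\<in>SL2. \<exists>b\<in>SL2. \<exists>c\<in>SL2.
    \<forall>V. openin M V \<and> V \<subseteq> U \<longrightarrow> openin (top_of_set split_torus) (two_sided a b c ` F ` V))"
proof -
  have man: "smooth_manifold M \<A>" and imm: "immersion M \<A> F"
    using acs by (auto simp: almost_complex_surface_def)
  have "p \<in> (\<Union>c\<in>\<A>. fst c)" using man p unfolding smooth_manifold_def by metis
  then obtain ch where ch: "ch \<in> \<A>" "p \<in> fst ch" by blast
  obtain U \<phi> where U: "ch = (U, \<phi>)" by (cases ch)
  have chart: "is_chart M ch" using man ch(1) by (auto simp: smooth_manifold_def)
  then have oU: "openin M U" and oS: "open (\<phi> ` U)"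
    and hom: "homeomorphic_map (subtopology M U) (top_of_set (\<phi> ` U)) \<phi>"
    by (auto simp: is_chart_def U)
  have UM: "U \<subseteq> topspace M" using oU by (rule openin_subset)
  have tU: "topspace (subtopology M U) = U" using UM by auto
  have inj: "inj_on \<phi> U" using homeomorphic_imp_injective_map[OF hom] unfolding tU .
  define f where "f = local_expr F ch"
  have fF: "f (\<phi> q) = F q" if "q \<in> U" for q
    using that inj by (simp add: f_def local_expr_def U)
  interpret flat_chart f "\<phi> ` U"
  proof
    show "smooth_on (\<phi> ` U) f" using imm ch(1) by (auto simp: immersion_def f_def U)
    have "F ` topspace M \<subseteq> SLSL" using imm by (simp add: immersion_def)
    then show "f u \<in> SLSL" if "u \<in> \<phi> ` U" for u using that UM fF by fastforce
    show "complex_J (f u) ` range (deriv_at f u) \<subseteq> range (deriv_at f u)" if "u \<in> \<phi> ` U" for u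
      using acs ch(1) that unfolding almost_complex_surface_def f_def U by fastforce
    show "metric_g (f u) (deriv_at f u x) (deriv_at f u x) > 0" if "u \<in> \<phi> ` U" "x \<noteq> 0" for u x
      using pos ch(1) that unfolding positive_definite_induced_metric_def f_def U by fastforce
    show "second_fundamental_form f u x y = 0" if "u \<in> \<phi> ` U" for u x y
      using tg ch(1) that unfolding totally_geodesic_def f_def U by fastforce
    show "gauss_curvature (induced_metric f) u = 0" if "u \<in> \<phi> ` U" for u
      using flat ch(1) that unfolding flat_surface_def f_def U by fastforce
  qed (rule oS)
  have pU: "p \<in> U" using ch(2) by (simp add: U)
  then have "\<phi> p \<in> \<phi> ` U" by (rule imageI)
  from local_torus[OF this] obtain r a b c where r: "r > 0" "ball (\<phi> p) r \<subseteq> \<phi> ` U"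
    and abc: "a \<in> SL2" "b \<in> SL2" "c \<in> SL2"
    and loc: "\<forall>W. open W \<and> W \<subseteq> ball (\<phi> p) r \<longrightarrow> openin (top_of_set split_torus) (two_sided a b c ` f ` W)"
    by (elim exE conjE bexE)
  define V0 where "V0 = {q \<in> U. \<phi> q \<in> ball (\<phi> p) r}"
  have "openin (subtopology M U) {q \<in> topspace (subtopology M U). \<phi> q \<in> ball (\<phi> p) r}"
    using r(2) homeomorphic_imp_continuous_map[OF hom]
    by (intro openin_continuous_map_preimage[where Y="top_of_set (\<phi> ` U)"]) (auto simp: openin_open)
  then have oV0: "openin M V0" unfolding tU V0_def using oU openin_trans_full by blast
  have loc': "openin (top_of_set split_torus) (two_sided a b c ` F ` V)" if V: "openin M V" "V \<subseteq> V0" for V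
  proof -
    have VU: "V \<subseteq> U" using V(2) by (auto simp: V0_def)
    have "openin (top_of_set (\<phi> ` U)) (\<phi> ` V)"
      using homeomorphic_imp_open_map[OF hom] V(1) VU oU by (auto simp: open_map_def openin_open_subtopology)
    then have "open (\<phi> ` V)" using oS openin_open_trans by blast
    moreover have "\<phi> ` V \<subseteq> ball (\<phi> p) r" using V(2) by (auto simp: V0_def)
    ultimately have "openin (top_of_set split_torus) (two_sided a b c ` f ` \<phi> ` V)" using loc by simp
    moreover have "f ` \<phi> ` V = F ` V" using VU fF by (force simp: image_image)
    ultimately show ?thesis by simp
  qed
  have "p \<in> V0" using pU r(1) by (simp add: V0_def)
  with oV0 abc loc' show ?thesis
    by (intro exI[of _ V0] conjI bexI[of _ a] bexI[of _ b] bexI[of _ c] allI impI) (elim conjE | assumption)+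
qed

theorem proposition4p2:
  fixes M :: "'m topology"
    and \<A> :: "('m, 2) chart set"
    and F :: "'m \<Rightarrow> mat2 \<times> mat2"
  assumes "almost_complex_surface M \<A> F"
    and "positive_definite_induced_metric \<A> F"
    and "totally_geodesic \<A> F"
    and "flat_surface \<A> F"
  shows "congruent_to M F (range (\<lambda>(s, t). (flat_A s t, flat_B s t)))"
proof (cases "topspace M = {}")
  case True
  have "mat 1 \<in> SL2" by (simp add: SL2_def)
  then have "ambient_isometry (two_sided (mat 1) (mat 1) (mat 1))" by (intro two_sided_isometry)
  then show ?thesis unfolding congruent_to_def True by auto
next
  case False
  define good where "good = (\<lambda>p U a b c. openin M U \<and> p \<in> U \<and> a \<in> SL2 \<and> b \<in> SL2 \<and> c \<in> SL2 \<and>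
    (\<forall>V. openin M V \<and> V \<subseteq> U \<longrightarrow> openin (top_of_set split_torus) (two_sided a b c ` F ` V)))"
  have "\<forall>p. \<exists>U a b c. p \<in> topspace M \<longrightarrow> good p U a b c"
    using surface_local_torus[OF assms] unfolding good_def by meson
  then obtain U a b c where good: "\<And>p. p \<in> topspace M \<Longrightarrow> good p (U p) (a p) (b p) (c p)"
    by metis
  define \<Phi> where "\<Phi> p = two_sided (a p) (b p) (c p)" for p
  define \<Psi> where "\<Psi> p = two_sided (adj2 (a p)) (adj2 (b p)) (adj2 (c p))" for p
  \<comment> \<open>the coset of the split torus that contains the image of \<open>U p\<close>\<close>
  define Q where "Q p = {x. \<Phi> p x \<in> split_torus}" for p
  have SL: "a p \<in> SL2" "b p \<in> SL2" "c p \<in> SL2" and oU: "openin M (U p)" "p \<in> U p"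
    and opn: "\<And>V. openin M V \<Longrightarrow> V \<subseteq> U p \<Longrightarrow> openin (top_of_set split_torus) (\<Phi> p ` F ` V)"
    if "p \<in> topspace M" for p
    using good[OF that] by (auto simp: good_def \<Phi>_def)
  have inv: "\<Psi> p (\<Phi> p x) = x" "\<Phi> p (\<Psi> p x) = x" if "p \<in> topspace M" for p x
    unfolding \<Phi>_def \<Psi>_def by (rule two_sided_inverse[OF SL[OF that]])+
  have comp: "\<Phi> q (\<Psi> p x) = two_sided (a q ** adj2 (a p)) (b q ** adj2 (b p)) (adj2 (c p) ** c q) x" for p q x
    by (simp add: \<Phi>_def \<Psi>_def two_sided_compose)
  \<comment> \<open>on overlapping neighbourhoods the change of isometry maps an open piece of the torus into the torus, hence preserves the torus\<close>
  have sub: "Q p \<subseteq> Q q" if p: "p \<in> topspace M" and q: "q \<in> topspace M" and ne: "U p \<inter> U q \<noteq> {}" for p q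
  proof -
    let ?V = "U p \<inter> U q" and ?R = "two_sided (a q ** adj2 (a p)) (b q ** adj2 (b p)) (adj2 (c p) ** c q)"
    have oV: "openin M ?V" using oU p q by blast
    have Op: "openin (top_of_set split_torus) (\<Phi> p ` F ` ?V)" and Oq: "openin (top_of_set split_torus) (\<Phi> q ` F ` ?V)"
      using opn[OF p oV] opn[OF q oV] by auto
    have "?R ` split_torus \<subseteq> split_torus"
    proof (rule torus_rigid[OF _ _ _ Op])
      have "?R ` \<Phi> p ` F ` ?V = \<Phi> q ` F ` ?V"
        by (simp add: image_image inv(1)[OF p] flip: comp)
      then show "?R ` \<Phi> p ` F ` ?V \<subseteq> split_torus" using openin_subset[OF Oq] by simp
    qed (use ne SL[OF p] SL[OF q] in \<open>auto intro: SL2_mult adj2_SL2\<close>)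
    then have "\<Phi> q (\<Psi> p (\<Phi> p x)) \<in> split_torus" if "x \<in> Q p" for x
      using that by (auto simp: comp Q_def)
    then show ?thesis by (auto simp: Q_def inv(1)[OF p])
  qed
  have Q_eq: "Q p = Q q" if "p \<in> topspace M" "q \<in> topspace M" "U p \<inter> U q \<noteq> {}" for p q
    using sub[OF that] sub[OF that(2,1)] that(3) by blast
  obtain p0 where p0: "p0 \<in> topspace M" using False by blast
  \<comment> \<open>the coset is locally constant, so the points with the coset of \<open>p0\<close> form a clopen set\<close>
  define K where "K = {p \<in> topspace M. Q p = Q p0}"
  have nbhd: "Q q = Q p" "q \<in> topspace M" if "p \<in> topspace M" "q \<in> U p" for p q
  proof -
    show "q \<in> topspace M" using that oU openin_subset by blast
    then show "Q q = Q p" using that oU by (intro Q_eq) auto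
  qed
  have "openin M (\<Union>p\<in>K. U p)" "openin M (\<Union>p\<in>topspace M - K. U p)"
    by (intro openin_Union; auto simp: K_def oU)+
  moreover have "(\<Union>p\<in>T. U p) = T" if "T = K \<or> T = topspace M - K" for T
  proof (intro equalityI subsetI)
    fix q assume "q \<in> (\<Union>p\<in>T. U p)"
    then obtain p where p: "p \<in> T" "q \<in> U p" by blast
    then have "p \<in> topspace M" using that by (auto simp: K_def)
    then show "q \<in> T" using nbhd[of p q] p that by (auto simp: K_def)
  next
    fix q assume "q \<in> T"
    then have "q \<in> topspace M" using that by (auto simp: K_def)
    then show "q \<in> (\<Union>p\<in>T. U p)" using oU(2) \<open>q \<in> T\<close> by blast
  qed
  ultimately have "openin M K" "openin M (topspace M - K)" by simp_all
  moreover from this have "closedin M K" by (auto simp: closedin_def K_def)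
  moreover have "connected_space M" using assms(1) by (simp add: almost_complex_surface_def)
  moreover have "p0 \<in> K" using p0 by (simp add: K_def)
  ultimately have "K = topspace M" by (auto simp: connected_space_clopen_in)
  then have Q0: "Q p = Q p0" if "p \<in> topspace M" for p using that by (auto simp: K_def)
  have "openin (top_of_set split_torus) (\<Phi> p0 ` F ` U p)" if p: "p \<in> topspace M" for p
  proof -
    \<comment> \<open>the change of isometry preserves the torus, so openness of the piece can be tested with the isometry of \<open>p\<close> itself\<close>
    let ?g = "\<lambda>x. \<Phi> p (\<Psi> p0 x)"
    have gt: "?g ` split_torus \<subseteq> split_torus"
    proof -
      have "\<Psi> p0 x \<in> Q p" if "x \<in> split_torus" for x
        unfolding Q0[OF p] by (simp add: Q_def inv(2)[OF p0] that)
      then show ?thesis by (auto simp: Q_def)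
    qed
    have "openin (top_of_set split_torus) (split_torus \<inter> ?g -` (\<Phi> p ` F ` U p))"
      unfolding comp
      by (rule continuous_openin_preimage[OF _ _ opn[OF p oU(1)[OF p] subset_refl]])
         (use gt in \<open>auto simp: comp intro: linear_continuous_on bounded_linear_two_sided\<close>)
    moreover have "split_torus \<inter> ?g -` (\<Phi> p ` F ` U p) = \<Phi> p0 ` F ` U p"
    proof (intro equalityI subsetI)
      fix x assume "x \<in> split_torus \<inter> ?g -` (\<Phi> p ` F ` U p)"
      then obtain q where "q \<in> U p" "\<Phi> p (\<Psi> p0 x) = \<Phi> p (F q)" by auto
      then show "x \<in> \<Phi> p0 ` F ` U p" using inv[OF p] inv[OF p0] by (metis imageI)
    next
      fix x assume "x \<in> \<Phi> p0 ` F ` U p"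
      then obtain q where q: "q \<in> U p" "x = \<Phi> p0 (F q)" by auto
      have "\<Phi> p (F q) \<in> split_torus"
        using opn[OF p oU(1)[OF p] subset_refl] openin_subset q(1) by fastforce
      then have "F q \<in> Q p0" unfolding Q0[OF p, symmetric] by (simp add: Q_def)
      then show "x \<in> split_torus \<inter> ?g -` (\<Phi> p ` F ` U p)" using q by (auto simp: Q_def inv(1)[OF p0])
    qed
    ultimately show ?thesis by simp
  qed
  then have "openin (top_of_set split_torus) (\<Union>p\<in>topspace M. \<Phi> p0 ` F ` U p)"
    by (intro openin_Union) auto
  moreover have "(\<Union>p\<in>topspace M. \<Phi> p0 ` F ` U p) = \<Phi> p0 ` F ` topspace M"
    using oU nbhd(2) by blast
  ultimately have "openin (top_of_set split_torus) (\<Phi> p0 ` F ` topspace M)" by simp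
  moreover have "ambient_isometry (\<Phi> p0)" unfolding \<Phi>_def by (rule two_sided_isometry[OF SL[OF p0]])
  ultimately show ?thesis unfolding congruent_to_def flat_torus by blast
qed

end
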